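(* Let $E$ be an elliptic curve over $K$ with $j$-invariant $j$. Then $E$ has potential good reduction if and only if $v(j)>0$.
   Context: $K$ is a complete discretely valued field of characteristic $0$ with valuation $v$ (with $v(0)=\infty$) and algebraically closed residue field $k$ of characteristic coprime to $6$ (i.e. $\mathrm{char}(k)=0$ or $\mathrm{char}(k)>3$). $E$ has potential good reduction if over some finite extension of $K$ it acquires good reduction.
   Formalization: The condition v(j)>0 is corrected to v(j)≥0: as printed the claim fails, e.g. y²=x³+x has discriminant −64, a unit, hence good reduction, but j=1728 has v(j)=0. *)

theory Defs
  imports
    "HOL-Algebra.Algebraic_Closure_Type"
    "HOL-Library.Extended_Real"
begin

section \<open>Discretely valued fields\<close>

text \<open>
  Valuations are written additively with values in the extended reals, on a subset \<open>L\<close> of a type;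
  \<open>L\<close> is meant to be a subfield. The value group is an infinite cyclic subgroup of the reals, not
  necessarily the integers, so that a valuation can literally be the restriction of one on a
  ramified extension.
\<close>

definition discrete_valuation_on :: "'b::field set \<Rightarrow> ('b \<Rightarrow> ereal) \<Rightarrow> bool" where
  "discrete_valuation_on L v \<longleftrightarrow>
     v 0 = \<infinity> \<and>
     (\<forall>x\<in>L. \<forall>y\<in>L. v (x * y) = v x + v y) \<and>
     (\<forall>x\<in>L. \<forall>y\<in>L. min (v x) (v y) \<le> v (x + y)) \<and>
     (\<exists>c>0. v ` (L - {0}) = range (\<lambda>n::int. ereal (c * of_int n)))"

definition complete_valuation :: "('a::field \<Rightarrow> ereal) \<Rightarrow> bool" where
  "complete_valuation v \<longleftrightarrow>
     (\<forall>s::nat \<Rightarrow> 'a.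
        (\<forall>C::real. \<exists>N. \<forall>m\<ge>N. \<forall>n\<ge>N. v (s m - s n) > ereal C) \<longrightarrow>
        (\<exists>l. \<forall>C::real. \<exists>N. \<forall>n\<ge>N. v (s n - l) > ereal C))"

definition valuation_ring :: "'b::field set \<Rightarrow> ('b \<Rightarrow> ereal) \<Rightarrow> 'b ring" where
  "valuation_ring L v = ring_of_type_algebra \<lparr>carrier := {x \<in> L. v x \<ge> 0}\<rparr>"

definition valuation_ideal :: "'b::field set \<Rightarrow> ('b \<Rightarrow> ereal) \<Rightarrow> 'b set" where
  "valuation_ideal L v = {x \<in> L. v x > 0}"

definition residue_field :: "'b::field set \<Rightarrow> ('b \<Rightarrow> ereal) \<Rightarrow> 'b set ring" where
  "residue_field L v = valuation_ring L v Quot valuation_ideal L v"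

text \<open>The counterpart of \<^const>\<open>semiring_char\<close> for rings with a carrier.\<close>

definition ring_char :: "('a, 'b) ring_scheme \<Rightarrow> nat" where
  "ring_char R = Gcd {n::nat. [n] \<cdot>\<^bsub>R\<^esub> \<one>\<^bsub>R\<^esub> = \<zero>\<^bsub>R\<^esub>}"

text \<open>Finite extensions of the base field are taken inside its algebraic closure.\<close>

definition finite_extension_field :: "'a::field alg_closure set \<Rightarrow> bool" where
  "finite_extension_field L \<longleftrightarrow>
     subfield L ring_of_type_algebra \<and> range to_ac \<subseteq> L \<and>
     ring.finite_dimension ring_of_type_algebra (range to_ac) L"

section \<open>Weierstrass equations\<close>

text \<open>The equation \<open>y\<^sup>2 + a1 x y + a3 y = x\<^sup>3 + a2 x\<^sup>2 + a4 x + a6\<close>.\<close>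

datatype 'a weierstrass = Weierstrass (a1: 'a) (a2: 'a) (a3: 'a) (a4: 'a) (a6: 'a)

text \<open>
  A point of the affine curve over \<open>R\<close> at which both partial derivatives vanish. The only point at
  infinity of the projective curve, \<open>[0 : 1 : 0]\<close>, is always smooth.
\<close>

definition singular_point ::
    "('a, 'b) ring_scheme \<Rightarrow> 'a weierstrass \<Rightarrow> 'a \<Rightarrow> 'a \<Rightarrow> bool" where
  "singular_point R W x y \<longleftrightarrow>
     (y [^] (2::nat) \<oplus> a1 W \<otimes> x \<otimes> y \<oplus> a3 W \<otimes> y)
       \<ominus> (x [^] (3::nat) \<oplus> a2 W \<otimes> x [^] (2::nat) \<oplus> a4 W \<otimes> x \<oplus> a6 W) = \<zero> \<and>
     a1 W \<otimes> y \<ominus> ([(3::nat)] \<cdot> (x [^] (2::nat)) \<oplus> [(2::nat)] \<cdot> (a2 W \<otimes> x) \<oplus> a4 W) = \<zero> \<and>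
     [(2::nat)] \<cdot> y \<oplus> a1 W \<otimes> x \<oplus> a3 W = \<zero>"
  for R (structure)

text \<open>This is smoothness of the curve when \<open>R\<close> is an algebraically closed field.\<close>

definition nonsingular :: "('a, 'b) ring_scheme \<Rightarrow> 'a weierstrass \<Rightarrow> bool" where
  "nonsingular R W \<longleftrightarrow> (\<forall>x \<in> carrier R. \<forall>y \<in> carrier R. \<not> singular_point R W x y)"

definition elliptic_curve :: "'a::field weierstrass \<Rightarrow> bool" where
  "elliptic_curve E \<longleftrightarrow>
     nonsingular (ring_of_type_algebra :: 'a alg_closure ring) (map_weierstrass to_ac E)"

definition b2 :: "'a::field weierstrass \<Rightarrow> 'a" where
  "b2 W = a1 W ^ 2 + 4 * a2 W"

definition b4 :: "'a::field weierstrass \<Rightarrow> 'a" where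
  "b4 W = 2 * a4 W + a1 W * a3 W"

definition b6 :: "'a::field weierstrass \<Rightarrow> 'a" where
  "b6 W = a3 W ^ 2 + 4 * a6 W"

definition b8 :: "'a::field weierstrass \<Rightarrow> 'a" where
  "b8 W = a1 W ^ 2 * a6 W + 4 * a2 W * a6 W - a1 W * a3 W * a4 W + a2 W * a3 W ^ 2 - a4 W ^ 2"

definition c4 :: "'a::field weierstrass \<Rightarrow> 'a" where
  "c4 W = b2 W ^ 2 - 24 * b4 W"

definition discriminant :: "'a::field weierstrass \<Rightarrow> 'a" where
  "discriminant W =
     - (b2 W ^ 2 * b8 W) - 8 * b4 W ^ 3 - 27 * b6 W ^ 2 + 9 * b2 W * b4 W * b6 W"

definition j_invariant :: "'a::field weierstrass \<Rightarrow> 'a" where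
  "j_invariant W = c4 W ^ 3 / discriminant W"

text \<open>
  The equation obtained by substituting \<open>x = u\<^sup>2 x' + r\<close> and \<open>y = u\<^sup>3 y' + u\<^sup>2 s x' + t\<close> and dividing
  by \<open>u\<^sup>6\<close>. These substitutions are all the isomorphisms between curves given by Weierstrass
  equations that preserve the point at infinity.
\<close>

definition change_variables ::
    "'a::field \<Rightarrow> 'a \<Rightarrow> 'a \<Rightarrow> 'a \<Rightarrow> 'a weierstrass \<Rightarrow> 'a weierstrass" where
  "change_variables u r s t W = Weierstrass
     ((a1 W + 2 * s) / u)
     ((a2 W - s * a1 W + 3 * r - s ^ 2) / u ^ 2)
     ((a3 W + r * a1 W + 2 * t) / u ^ 3)
     ((a4 W - s * a3 W + 2 * r * a2 W - (t + r * s) * a1 W + 3 * r ^ 2 - 2 * s * t) / u ^ 4)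
     ((a6 W + r * a4 W + r ^ 2 * a2 W + r ^ 3 - t * a3 W - t ^ 2 - r * t * a1 W) / u ^ 6)"

section \<open>Good reduction\<close>

definition integral_model ::
    "'b::field set \<Rightarrow> ('b \<Rightarrow> ereal) \<Rightarrow> 'b weierstrass \<Rightarrow> 'b weierstrass \<Rightarrow> bool" where
  "integral_model L v E W \<longleftrightarrow>
     (\<exists>u\<in>L. \<exists>r\<in>L. \<exists>s\<in>L. \<exists>t\<in>L. u \<noteq> 0 \<and> W = change_variables u r s t E) \<and>
     set_weierstrass W \<subseteq> carrier (valuation_ring L v)"

definition minimal_model ::
    "'b::field set \<Rightarrow> ('b \<Rightarrow> ereal) \<Rightarrow> 'b weierstrass \<Rightarrow> 'b weierstrass \<Rightarrow> bool" where
  "minimal_model L v E W \<longleftrightarrow>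
     integral_model L v E W \<and>
     (\<forall>W'. integral_model L v E W' \<longrightarrow> v (discriminant W) \<le> v (discriminant W'))"

definition reduction ::
    "'b::field set \<Rightarrow> ('b \<Rightarrow> ereal) \<Rightarrow> 'b weierstrass \<Rightarrow> 'b set weierstrass" where
  "reduction L v = map_weierstrass (\<lambda>a. valuation_ideal L v +>\<^bsub>valuation_ring L v\<^esub> a)"

text \<open>
  For \<open>E\<close> with coefficients in \<open>L\<close>. Testing smoothness of the reduced curve on the points over the
  residue field is appropriate for an algebraically closed residue field; below, \<open>L\<close> is a finite
  extension of a field whose residue field is algebraically closed, so it has the same residue
  field.
\<close>

definition good_reduction ::
    "'b::field set \<Rightarrow> ('b \<Rightarrow> ereal) \<Rightarrow> 'b weierstrass \<Rightarrow> bool" where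
  "good_reduction L v E \<longleftrightarrow>
     (\<exists>W. minimal_model L v E W \<and> nonsingular (residue_field L v) (reduction L v W))"

text \<open>The extension \<open>w\<close> of a complete valuation \<open>v\<close> to a finite extension \<open>L\<close> exists and is unique.\<close>

definition potential_good_reduction :: "('a::field \<Rightarrow> ereal) \<Rightarrow> 'a weierstrass \<Rightarrow> bool" where
  "potential_good_reduction v E \<longleftrightarrow>
     (\<exists>L w. finite_extension_field L \<and>
            discrete_valuation_on L w \<and> (\<forall>x. w (to_ac x) = v x) \<and>
            good_reduction L w (map_weierstrass to_ac E))"

end

theory Submission
  imports Defs
begin

text \<open>
  A Weierstrass equation over a field of characteristic different from 2 and 3 has a singular point,
  rational over that field, as soon as its discriminant vanishes. So good reduction forces the
  discriminant of a minimal equation to be a unit, which makes \<open>j = c4\<^sup>3 / \<Delta>\<close> integral.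

  Conversely, adjoin a twelfth root \<open>\<rho>\<close> of a uniformizer. This extension is totally ramified, so
  some \<open>u\<close> in it satisfies \<open>12 v(u) = v(\<Delta>)\<close>, and the short equation scaled by \<open>u\<close> has unit
  discriminant. Its invariant \<open>c4\<close> is integral because \<open>j\<close> is, then \<open>c6\<close> is because
  \<open>c6\<^sup>2 = c4\<^sup>3 - 1728 \<Delta>\<close>, hence so are its coefficients. The valuation on the extension is the
  minimum of the weights \<open>v(a_i) + i v(\<rho>)\<close> of the terms of \<open>\<Sum> a_i \<rho>^i\<close>, which for \<open>i < 12\<close> are
  pairwise distinct.
\<close>

section \<open>Weierstrass equations\<close>

text \<open>Introduced because \<open>c4\<close> and \<open>c6\<close> are, up to constants, the two
  coefficients of the short form and \<open>c6 ^ 2\<close> is integral once \<open>c4 ^ 3\<close>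
  and the discriminant are.\<close>

definition c6 :: "'a::field weierstrass \<Rightarrow> 'a" where
  "c6 W = - (b2 W ^ 3) + 36 * b2 W * b4 W - 216 * b6 W"

text \<open>Unfolding numeral powers into products lets both sides of a polynomial identity
  normalize to the same sum of monomials.\<close>

lemmas ring_expand = algebra_simps power_numeral_reduce

text \<open>As polynomials in the \<open>b\<close> invariants, the two discriminant identities below
  hold only modulo this relation.\<close>

lemma four_b8: "4 * b8 W = b2 W * b6 W - b4 W ^ 2"
  unfolding b2_def b4_def b6_def b8_def by (simp add: ring_expand)

lemma c4_cubed_minus_c6_squared: "c4 W ^ 3 - c6 W ^ 2 = 1728 * discriminant W"
proof -
  \<comment> \<open>Splitting \<open>1728 = 432 * 4\<close> makes \<open>b8\<close> occur as
    \<open>4 * b8\<close>, which can be eliminated without dividing by 4.\<close>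
  have "1728 * discriminant W
    = 432 * (- (b2 W ^ 2 * (4 * b8 W)) - 32 * b4 W ^ 3 - 108 * b6 W ^ 2 + 36 * b2 W * b4 W * b6 W)"
    unfolding discriminant_def by (simp add: ring_expand)
  then show ?thesis
    unfolding four_b8 c4_def c6_def by (simp add: ring_expand)
qed

section \<open>Invariants under a change of variables\<close>

lemma
  fixes u r s t :: "'a::field" and W :: "'a weierstrass"
  defines "W' \<equiv> change_variables u r s t W"
  shows b2_change_variables: "b2 W' = (b2 W + 12 * r) / u ^ 2"
    and b4_change_variables: "b4 W' = (b4 W + r * b2 W + 6 * r ^ 2) / u ^ 4"
    and b6_change_variables: "b6 W' = (b6 W + 2 * r * b4 W + r ^ 2 * b2 W + 4 * r ^ 3) / u ^ 6"
    and b8_change_variables: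
      "b8 W' = (b8 W + 3 * r * b6 W + 3 * r ^ 2 * b4 W + r ^ 3 * b2 W + 3 * r ^ 4) / u ^ 8"
proof -
  \<comment> \<open>With \<open>z\<close> in place of division every claim is a polynomial identity
    in \<open>z\<close>, valid also for \<open>u = 0\<close>, where \<open>z = 0\<close>.\<close>
  define z where "z = inverse u"
  have a: "a1 W' = (a1 W + 2 * s) * z"
    "a2 W' = (a2 W - s * a1 W + 3 * r - s ^ 2) * z ^ 2"
    "a3 W' = (a3 W + r * a1 W + 2 * t) * z ^ 3"
    "a4 W' = (a4 W - s * a3 W + 2 * r * a2 W - (t + r * s) * a1 W + 3 * r ^ 2 - 2 * s * t) * z ^ 4"
    "a6 W' = (a6 W + r * a4 W + r ^ 2 * a2 W + r ^ 3 - t * a3 W - t ^ 2 - r * t * a1 W) * z ^ 6"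
    by (simp_all add: W'_def change_variables_def z_def divide_inverse power_inverse)
  note z = divide_inverse power_inverse[symmetric] z_def[symmetric]
  show "b2 W' = (b2 W + 12 * r) / u ^ 2"
    unfolding z b2_def a by (simp add: ring_expand)
  show "b4 W' = (b4 W + r * b2 W + 6 * r ^ 2) / u ^ 4"
    unfolding z b2_def b4_def a by (simp add: ring_expand)
  show "b6 W' = (b6 W + 2 * r * b4 W + r ^ 2 * b2 W + 4 * r ^ 3) / u ^ 6"
    unfolding z b2_def b4_def b6_def a by (simp add: ring_expand)
  show "b8 W' = (b8 W + 3 * r * b6 W + 3 * r ^ 2 * b4 W + r ^ 3 * b2 W + 3 * r ^ 4) / u ^ 8"
    unfolding z b2_def b4_def b6_def b8_def a by (simp add: ring_expand)
qed

lemma c4_change_variables: "c4 (change_variables u r s t W) = c4 W / u ^ 4"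
proof -
  define z where "z = inverse u"
  show ?thesis
    unfolding c4_def b2_change_variables b4_change_variables
      divide_inverse power_inverse[symmetric] z_def[symmetric] by (simp add: ring_expand)
qed

lemma discriminant_change_variables:
  "discriminant (change_variables u r s t W) = discriminant W / u ^ 12"
proof -
  define z where "z = inverse u"
  \<comment> \<open>The difference is an explicit multiple of the relation \<open>four_b8\<close>,
    hence zero.\<close>
  have "discriminant (change_variables u r s t W) - discriminant W / u ^ 12
    = (4 * b8 W - (b2 W * b6 W - b4 W ^ 2)) * z ^ 12 * (- 6 * r * b2 W - 36 * r ^ 2)"
    unfolding discriminant_def b2_change_variables b4_change_variables
      b6_change_variables b8_change_variables
      divide_inverse power_inverse[symmetric] z_def[symmetric]
    by (simp add: ring_expand)
  then show ?thesis
    unfolding four_b8 by simp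
qed

lemma j_invariant_change_variables:
  assumes "u \<noteq> 0"
  shows "j_invariant (change_variables u r s t W) = j_invariant W"
  using assms
  by (simp add: j_invariant_def c4_change_variables discriminant_change_variables
      power_divide power_mult[symmetric])

lemma map_weierstrass_to_ac:
  fixes W :: "'a::field weierstrass"
  shows "discriminant (map_weierstrass to_ac W) = to_ac (discriminant W)"
    and "j_invariant (map_weierstrass to_ac W) = to_ac (j_invariant W)"
  by (simp_all add: j_invariant_def c4_def discriminant_def b2_def b4_def b6_def b8_def
      weierstrass.map_sel)

text \<open>
  Double roots of \<open>z\<^sup>3 - 3 c4 z - 2 c6\<close> correspond to singular points on the line
  \<open>2 y + a1 x + a3 = 0\<close>; for \<open>c4 \<noteq> 0\<close> and discriminant zero the double root is \<open>- c6 / c4\<close>, so it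
  is rational over any field where 2 and 3 are invertible.
\<close>

lemma
  fixes p q z :: "'a::field"
  assumes y: "a3 W = - 2 * q - a1 W * p" and z: "z = 12 * p + b2 W"
  shows weierstrass_depressed:
      "1728 * ((q ^ 2 + a1 W * p * q + a3 W * q) - (p ^ 3 + a2 W * p ^ 2 + a4 W * p + a6 W))
       = - (z ^ 3 - 3 * c4 W * z - 2 * c6 W)"
    and weierstrass_deriv_depressed:
      "48 * (a1 W * q - (3 * p ^ 2 + 2 * (a2 W * p) + a4 W)) = - (z ^ 2 - c4 W)"
  unfolding z c4_def c6_def b2_def b4_def b6_def y by (simp_all add: ring_expand)

text \<open>Completing the square removes \<open>a1\<close> and \<open>a3\<close>; completing the
  cube removes \<open>a2\<close>.\<close>

lemma change_variables_short:
  fixes u :: "'a::field" and W :: "'a weierstrass"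
  assumes 2: "(2::'a) \<noteq> 0" and 3: "(3::'a) \<noteq> 0"
  defines "r \<equiv> - b2 W / 12"
  shows "change_variables u r (- a1 W / 2) (- (a3 W + r * a1 W) / 2) W
    = Weierstrass 0 0 0 (- c4 W / (48 * u ^ 4)) (- c6 W / (864 * u ^ 6))"
proof -
  \<comment> \<open>The field is arbitrary, so the numerals are factored into twos and threes to see
    that they are nonzero.\<close>
  have n: "(4::'a) = 2 * 2" "(12::'a) = 2 * 2 * 3" "(48::'a) = 2 * 2 * 2 * 2 * 3"
    "(864::'a) = 2 * 2 * 2 * 2 * 2 * 3 * 3 * 3"
    by simp_all
  have n0: "(4::'a) \<noteq> 0" "(12::'a) \<noteq> 0" "(48::'a) \<noteq> 0" "(864::'a) \<noteq> 0"
    unfolding n using 2 3 by (simp_all only: mult_eq_0_iff de_Morgan_disj simp_thms)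
  define s where "s = - a1 W / 2"
  define t where "t = - (a3 W + r * a1 W) / 2"
  \<comment> \<open>Expressing the old \<open>a1\<close>, \<open>a2\<close>, \<open>a3\<close>
    through \<open>r\<close>, \<open>s\<close>, \<open>t\<close> turns the formulas for
    \<open>c4\<close> and \<open>c6\<close> into identities without division.\<close>
  have a1: "a1 W = - 2 * s" and "2 * t = - (a3 W + r * a1 W)" and "b2 W = - 12 * r"
    using n0 2 by (simp_all add: r_def s_def t_def)
  then have a3: "a3 W = 2 * r * s - 2 * t" and "4 * a2 W = 4 * (- 3 * r - s ^ 2)"
    unfolding b2_def by (simp_all add: ring_expand)
  with n0 have a2: "a2 W = - 3 * r - s ^ 2"
    using mult_cancel_left[of 4 "a2 W" "- 3 * r - s ^ 2"] by blast
  have A: "- c4 W = 48 * (a4 W - s * a3 W + 2 * r * a2 W - (t + r * s) * a1 W + 3 * r ^ 2 - 2 * s * t)"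
    unfolding c4_def b2_def b4_def a1 a2 a3 by (simp add: ring_expand)
  have B: "- c6 W = 864 * (a6 W + r * a4 W + r ^ 2 * a2 W + r ^ 3 - t * a3 W - t ^ 2 - r * t * a1 W)"
    unfolding c6_def b2_def b4_def b6_def a1 a2 a3 by (simp add: ring_expand)
  show ?thesis
    unfolding s_def[symmetric] t_def[symmetric] change_variables_def A B
    unfolding mult_divide_mult_cancel_left[OF n0(3)] mult_divide_mult_cancel_left[OF n0(4)]
    by (simp add: a1 a2 a3 power2_eq_square)
qed

lemma discriminant_short: "discriminant (Weierstrass 0 0 0 A B) = - 16 * (4 * A ^ 3 + 27 * B ^ 2)"
  by (simp add: discriminant_def b2_def b4_def b6_def b8_def ring_expand)

section \<open>Transfer of singular points along ring homomorphisms\<close>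

lemma of_type_algebra_simps [simp]:
  "carrier ring_of_type_algebra = UNIV"
  "x \<otimes>\<^bsub>ring_of_type_algebra\<^esub> y = x * y"
  "x \<oplus>\<^bsub>ring_of_type_algebra\<^esub> y = x + y"
  "\<zero>\<^bsub>ring_of_type_algebra\<^esub> = 0"
  "\<one>\<^bsub>ring_of_type_algebra\<^esub> = 1"
  by (simp_all add: ring_of_type_algebra_def)

text \<open>The homomorphism commutes with the three polynomials that define a singular point. It
  serves for the residue map of a valuation ring and for the identity of the algebraic
  closure.\<close>

lemma singular_point_hom:
  fixes W :: "'b::comm_ring_1 weierstrass"
  assumes hom: "ring_hom_ring (ring_of_type_algebra\<lparr>carrier := S\<rparr>) Q h"
    and W: "set_weierstrass W \<subseteq> S" and xy: "x \<in> S" "y \<in> S"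
  shows "singular_point Q (map_weierstrass h W) (h x) (h y) \<longleftrightarrow>
    h ((y ^ 2 + a1 W * x * y + a3 W * y) - (x ^ 3 + a2 W * x ^ 2 + a4 W * x + a6 W)) = \<zero>\<^bsub>Q\<^esub> \<and>
    h (a1 W * y - (3 * x ^ 2 + 2 * (a2 W * x) + a4 W)) = \<zero>\<^bsub>Q\<^esub> \<and>
    h (2 * y + a1 W * x + a3 W) = \<zero>\<^bsub>Q\<^esub>"
proof -
  interpret ring_hom_ring "ring_of_type_algebra\<lparr>carrier := S\<rparr>" Q h by (rule hom)
  have coeffs: "a1 W \<in> S" "a2 W \<in> S" "a3 W \<in> S" "a4 W \<in> S" "a6 W \<in> S"
    using W by (cases W; simp)+
  have add_in: "p + q \<in> S" and mult_in: "p * q \<in> S" if "p \<in> S" "q \<in> S" for p q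
    using that R.add.m_closed[of p q] R.m_closed[of p q] by simp_all
  have one_in: "1 \<in> S" and zero_in: "0 \<in> S"
    using R.one_closed R.zero_closed by simp_all
  have pow_in: "p ^ n \<in> S" if "p \<in> S" for p and n :: nat
    using that by (induction n) (auto intro: one_in mult_in)
  have smult_in: "of_nat n * p \<in> S" if "p \<in> S" for p and n :: nat
    using that by (induction n) (auto simp: ring_expand intro: zero_in add_in)
  have add: "h (p + q) = h p \<oplus>\<^bsub>Q\<^esub> h q" and mult: "h (p * q) = h p \<otimes>\<^bsub>Q\<^esub> h q" if "p \<in> S" "q \<in> S" for p q
    using that hom_add[of p q] hom_mult[of p q] by simp_all
  \<comment> \<open>Uniqueness of additive inverses identifies the negation of the ring with carrier
    \<open>S\<close> with that of the type.\<close>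
  have diff: "h (p - q) = h p \<ominus>\<^bsub>Q\<^esub> h q" if "p \<in> S" "q \<in> S" for p q
  proof -
    have "q + (\<ominus>\<^bsub>ring_of_type_algebra\<lparr>carrier := S\<rparr>\<^esub> q) = 0"
      using R.r_neg[of q] that by simp
    then have "\<ominus>\<^bsub>ring_of_type_algebra\<lparr>carrier := S\<rparr>\<^esub> q = - q"
      by (simp add: eq_neg_iff_add_eq_0 add.commute)
    then have "- q \<in> S" "h (- q) = \<ominus>\<^bsub>Q\<^esub> h q"
      using hom_a_inv[of q] R.a_inv_closed[of q] that by simp_all
    then show ?thesis
      using add[of p "- q"] that by (simp add: a_minus_def)
  qed
  have pow: "h p [^]\<^bsub>Q\<^esub> n = h (p ^ n)" if "p \<in> S" for p and n :: nat
  proof (induction n)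
    case 0
    then show ?case using hom_one by simp
  next
    case (Suc n)
    then show ?case
      using mult[of "p ^ n" p] pow_in[OF that, of n] that by (simp add: power_commutes)
  qed
  have smult: "[n] \<cdot>\<^bsub>Q\<^esub> h p = h (of_nat n * p)" if "p \<in> S" for p and n :: nat
  proof (induction n)
    case 0
    then show ?case using hom_zero by simp
  next
    case (Suc n)
    have "[Suc n] \<cdot>\<^bsub>Q\<^esub> h p = h (of_nat n * p) \<oplus>\<^bsub>Q\<^esub> h p"
      using Suc by (simp add: add_pow_def nat_pow_def)
    also have "\<dots> = h (of_nat (Suc n) * p)"
      using add[of "of_nat n * p" p] smult_in[OF that, of n] that by (simp add: ring_expand)
    finally show ?case .
  qed
  have numeral_mult: "2 * p \<in> S" "3 * p \<in> S" "h (2 * p) = [(2::nat)] \<cdot>\<^bsub>Q\<^esub> h p" "h (3 * p) = [(3::nat)] \<cdot>\<^bsub>Q\<^esub> h p"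
    if "p \<in> S" for p
    using smult[OF that] smult_in[OF that, of 2] smult_in[OF that, of 3] by simp_all
  show ?thesis
    unfolding singular_point_def
    by (simp add: add mult diff pow[symmetric] numeral_mult add_in mult_in pow_in coeffs xy
        weierstrass.map_sel)
qed

section \<open>Reduction modulo the maximal ideal\<close>

text \<open>The carrier is a set because an extension is only a subset of the algebraic closure; the
  base field is the case \<open>L = UNIV\<close>.\<close>

locale valued_subfield =
  fixes L :: "'b::field set" and v :: "'b \<Rightarrow> ereal"
  assumes subfield_L: "subfield L ring_of_type_algebra"
    and valuation: "discrete_valuation_on L v"
begin

lemma L_closed [simp, intro]:
  "0 \<in> L" "1 \<in> L"
  "x \<in> L \<Longrightarrow> y \<in> L \<Longrightarrow> x + y \<in> L"
  "x \<in> L \<Longrightarrow> y \<in> L \<Longrightarrow> x * y \<in> L"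
  "x \<in> L \<Longrightarrow> - x \<in> L"
  "x \<in> L \<Longrightarrow> inverse x \<in> L"
proof -
  interpret R: field "ring_of_type_algebra :: 'b ring" by (rule field_from_type_algebra)
  note sub = subringE[OF subfieldE(1)[OF subfield_L]]
  show "0 \<in> L" "1 \<in> L" "x \<in> L \<Longrightarrow> y \<in> L \<Longrightarrow> x + y \<in> L" "x \<in> L \<Longrightarrow> y \<in> L \<Longrightarrow> x * y \<in> L"
    using sub(2,3,6,7) by simp_all
  have "\<ominus>\<^bsub>ring_of_type_algebra :: 'b ring\<^esub> x = - x"
    by (rule R.minus_equality) auto
  then show "x \<in> L \<Longrightarrow> - x \<in> L"
    using sub(5) by metis
  show "inverse x \<in> L" if "x \<in> L"
  proof (cases "x = 0")
    case True
    then show ?thesis using that by simp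
  next
    case False
    have "inv\<^bsub>ring_of_type_algebra :: 'b ring\<^esub> x = inverse x"
      by (rule R.comm_inv_char) (use False in auto)
    then show ?thesis
      using R.subfield_m_inv(1)[OF subfield_L, of x] that False by auto
  qed
qed

lemma L_closed' [simp, intro]:
  "x \<in> L \<Longrightarrow> y \<in> L \<Longrightarrow> x - y \<in> L"
  "x \<in> L \<Longrightarrow> y \<in> L \<Longrightarrow> x / y \<in> L"
  "x \<in> L \<Longrightarrow> x ^ n \<in> L"
  "of_nat n \<in> L"
  "numeral k \<in> L"
proof -
  show "x \<in> L \<Longrightarrow> y \<in> L \<Longrightarrow> x - y \<in> L"
    using L_closed(3)[of x "- y"] by simp
  show "x \<in> L \<Longrightarrow> y \<in> L \<Longrightarrow> x / y \<in> L"
    unfolding divide_inverse by simp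
  show "x \<in> L \<Longrightarrow> x ^ n \<in> L"
    by (induction n) auto
  show *: "of_nat n \<in> L" for n
    by (induction n) auto
  show "numeral k \<in> L"
    using *[of "numeral k"] by simp
qed

lemma v_0 [simp]: "v 0 = \<infinity>"
  and v_mult: "x \<in> L \<Longrightarrow> y \<in> L \<Longrightarrow> v (x * y) = v x + v y"
  and v_add: "x \<in> L \<Longrightarrow> y \<in> L \<Longrightarrow> min (v x) (v y) \<le> v (x + y)"
  using valuation by (auto simp: discrete_valuation_on_def)

lemma v_finite:
  assumes "x \<in> L" "x \<noteq> 0"
  shows "\<bar>v x\<bar> \<noteq> \<infinity>"
proof -
  have "\<exists>c. v ` (L - {0}) = range (\<lambda>n::int. ereal (c * of_int n))"
    using valuation by (auto simp: discrete_valuation_on_def)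
  then obtain c where "v ` (L - {0}) = range (\<lambda>n::int. ereal (c * of_int n))" ..
  moreover have "v x \<in> v ` (L - {0})" using assms by blast
  ultimately show ?thesis by auto
qed

lemma v_eq_infinity_iff: "x \<in> L \<Longrightarrow> v x = \<infinity> \<longleftrightarrow> x = 0"
  using v_finite by fastforce

lemma v_not_MInf: "x \<in> L \<Longrightarrow> v x \<noteq> - \<infinity>"
  using v_finite[of x] by (cases "x = 0") auto

lemma v_1 [simp]: "v 1 = 0"
  using v_mult[of 1 1] v_finite[of 1] by (cases "v 1") auto

lemma v_power:
  assumes "x \<in> L"
  shows "v (x ^ n) = ereal (real n) * v x"
proof (induction n)
  case (Suc n)
  show ?case
    using assms v_not_MInf[OF assms] Suc
    by (cases "v x"; cases n) (simp_all add: v_mult algebra_simps)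
qed (simp add: zero_ereal_def[symmetric])

lemma v_minus:
  assumes "x \<in> L"
  shows "v (- x) = v x"
proof -
  have "v (- 1) + v (- 1) = v ((- 1) * (- 1))"
    using v_mult[of "- 1" "- 1"] by simp
  then have "v (- 1) = 0"
    by (cases "v (- 1)") auto
  then show ?thesis
    using v_mult[of "- 1" x] assms by simp
qed

lemma v_inverse:
  assumes "x \<in> L" "x \<noteq> 0"
  shows "v (inverse x) = - v x"
  using v_mult[of x "inverse x"] assms v_finite[OF assms] v_finite[of "inverse x"]
  by (cases "v x"; cases "v (inverse x)") auto

section \<open>Consequences of the ultrametric inequality\<close>

lemma v_add_gt: "x \<in> L \<Longrightarrow> y \<in> L \<Longrightarrow> t < v x \<Longrightarrow> t < v y \<Longrightarrow> t < v (x + y)"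
  and v_add_ge: "x \<in> L \<Longrightarrow> y \<in> L \<Longrightarrow> t \<le> v x \<Longrightarrow> t \<le> v y \<Longrightarrow> t \<le> v (x + y)"
  using v_add[of x y] by (auto simp: min_def split: if_splits)

lemma v_add_eq:
  assumes "x \<in> L" "y \<in> L" "v x < v y"
  shows "v (x + y) = v x"
proof (rule antisym)
  show "v x \<le> v (x + y)" using v_add[of x y] assms by simp
  \<comment> \<open>Here \<open>x\<close> is written as \<open>(x + y) - y\<close>; as
    \<open>v y\<close> exceeds \<open>v x\<close>, the minimum must be
    \<open>v (x + y)\<close>.\<close>
  have "min (v (x + y)) (v y) \<le> v x"
    using v_add[of "x + y" "- y"] assms by (simp add: v_minus)
  then show "v (x + y) \<le> v x" using assms(3) by (auto simp: min_def split: if_splits)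
qed

lemma v_sum_gt:
  assumes "finite A" "\<And>i. i \<in> A \<Longrightarrow> f i \<in> L" "\<And>i. i \<in> A \<Longrightarrow> ereal t < v (f i)"
  shows "ereal t < v (\<Sum>i\<in>A. f i)"
proof -
  have "(\<Sum>i\<in>A. f i) \<in> L \<and> ereal t < v (\<Sum>i\<in>A. f i)"
    using assms by (induction A rule: finite_induct) (auto intro: v_add_gt)
  then show ?thesis ..
qed

section \<open>The valuation ring \<O> and its maximal ideal \<M>\<close>

abbreviation "\<O> \<equiv> {x \<in> L. 0 \<le> v x}"
abbreviation "\<M> \<equiv> {x \<in> L. 0 < v x}"

lemma O_closed:
  "0 \<in> \<O>" "1 \<in> \<O>"
  "x \<in> \<O> \<Longrightarrow> y \<in> \<O> \<Longrightarrow> x + y \<in> \<O>"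
  "x \<in> \<O> \<Longrightarrow> y \<in> \<O> \<Longrightarrow> x * y \<in> \<O>"
  "x \<in> \<O> \<Longrightarrow> - x \<in> \<O>"
  "x \<in> \<O> \<Longrightarrow> y \<in> \<O> \<Longrightarrow> x - y \<in> \<O>"
  using v_add_ge[of x "- y"] by (auto simp: v_mult v_minus intro: v_add_ge)

lemma O_power: "x \<in> \<O> \<Longrightarrow> x ^ n \<in> \<O>"
  by (induction n) (auto simp: v_mult)

lemma O_of_nat: "of_nat n \<in> \<O>"
  by (induction n) (auto intro: v_add_ge)

lemma O_numeral: "numeral k \<in> \<O>"
  using O_of_nat[of "numeral k"] by simp

lemmas O_intros = O_closed O_power O_numeral

lemma M_closed:
  "0 \<in> \<M>"
  "x \<in> \<M> \<Longrightarrow> y \<in> \<M> \<Longrightarrow> x + y \<in> \<M>"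
  "x \<in> \<M> \<Longrightarrow> - x \<in> \<M>"
  "x \<in> \<M> \<Longrightarrow> y \<in> \<M> \<Longrightarrow> x - y \<in> \<M>"
  "x \<in> \<M> \<Longrightarrow> y \<in> \<O> \<Longrightarrow> x * y \<in> \<M>"
  "x \<in> \<O> \<Longrightarrow> y \<in> \<M> \<Longrightarrow> x * y \<in> \<M>"
  using v_add_gt[of x "- y"]
  by (auto simp: v_mult v_minus intro: v_add_gt add_pos_nonneg add_nonneg_pos)

lemma M_power: "0 < n \<Longrightarrow> x \<in> \<M> \<Longrightarrow> x ^ n \<in> \<M>"
  by (induction n rule: nat_induct_non_zero) (auto simp: v_mult intro: add_pos_pos)

lemma M_powerD:
  assumes "x ^ n \<in> \<M>" "x \<in> L"
  shows "x \<in> \<M>"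
  using assms v_not_MInf by (cases "v x") (auto simp: v_power zero_less_mult_iff)

lemma O_powerD:
  assumes "x ^ n \<in> \<O>" "x \<in> L" "0 < n"
  shows "x \<in> \<O>"
  using assms v_not_MInf by (cases "v x") (auto simp: v_power zero_le_mult_iff)

lemma M_unit_cancel:
  assumes "y * x \<in> \<M>" "x \<in> L" "y \<in> L" "v y = 0"
  shows "x \<in> \<M>"
  using assms by (simp add: v_mult)

lemma O_inverse: "x \<in> L \<Longrightarrow> v x = 0 \<Longrightarrow> inverse x \<in> \<O>"
  by (cases "x = 0") (auto simp: v_inverse)

section \<open>The residue field as a quotient ring\<close>

lemma valuation_ring_subring: "subring \<O> ring_of_type_algebra"
proof -
  interpret R: ring "ring_of_type_algebra :: 'b ring" by (rule ring_from_type_algebra)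
  have "\<ominus>\<^bsub>ring_of_type_algebra :: 'b ring\<^esub> x = - x" for x
    by (rule R.minus_equality) auto
  then show ?thesis
    using O_closed by (intro R.subringI) auto
qed

lemma valuation_ring_eq: "valuation_ring L v = ring_of_type_algebra\<lparr>carrier := \<O>\<rparr>"
  by (simp add: valuation_ring_def)

lemma valuation_ring_simps:
  "carrier (valuation_ring L v) = \<O>"
  "x \<otimes>\<^bsub>valuation_ring L v\<^esub> y = x * y"
  "x \<oplus>\<^bsub>valuation_ring L v\<^esub> y = x + y"
  "\<zero>\<^bsub>valuation_ring L v\<^esub> = 0"
  "\<one>\<^bsub>valuation_ring L v\<^esub> = 1"
  by (simp_all add: valuation_ring_eq)

lemma ring_valuation_ring: "ring (valuation_ring L v)"
  unfolding valuation_ring_eq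
  by (rule ring.subring_is_ring[OF ring_from_type_algebra valuation_ring_subring])

lemma ideal_valuation_ideal: "ideal (valuation_ideal L v) (valuation_ring L v)"
proof -
  interpret V: ring "valuation_ring L v" by (rule ring_valuation_ring)
  show ?thesis
  proof (rule idealI[OF V.ring_axioms])
    show "subgroup (valuation_ideal L v) (add_monoid (valuation_ring L v))"
    proof (rule group.subgroupI[OF V.a_group])
      fix x assume x: "x \<in> valuation_ideal L v"
      have "\<ominus>\<^bsub>valuation_ring L v\<^esub> x = - x"
        by (rule V.minus_equality)
          (use x in \<open>auto simp: valuation_ring_simps valuation_ideal_def v_minus\<close>)
      then show "inv\<^bsub>add_monoid (valuation_ring L v)\<^esub> x \<in> valuation_ideal L v"
        using x by (auto simp: valuation_ideal_def v_minus a_inv_def)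
    qed (use M_closed in \<open>auto simp: valuation_ring_simps valuation_ideal_def\<close>)
  qed (use M_closed in \<open>auto simp: valuation_ring_simps valuation_ideal_def\<close>)
qed

lemma ring_hom_residue:
  "ring_hom_ring (valuation_ring L v) (residue_field L v)
     ((+>\<^bsub>valuation_ring L v\<^esub>) (valuation_ideal L v))"
  unfolding residue_field_def by (rule ideal.rcos_ring_hom_ring[OF ideal_valuation_ideal])

lemma residue_zero_iff:
  assumes "x \<in> \<O>"
  shows "valuation_ideal L v +>\<^bsub>valuation_ring L v\<^esub> x = \<zero>\<^bsub>residue_field L v\<^esub> \<longleftrightarrow> x \<in> \<M>"
proof -
  interpret I: ideal "valuation_ideal L v" "valuation_ring L v"
    by (rule ideal_valuation_ideal)
  have "valuation_ideal L v +>\<^bsub>valuation_ring L v\<^esub> x = \<zero>\<^bsub>residue_field L v\<^esub> \<longleftrightarrow> x \<in> valuation_ideal L v"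
    using I.rcos_const_imp_mem[of x] I.a_rcos_const[of x] assms
    by (auto simp: residue_field_def FactRing_def valuation_ring_simps)
  then show ?thesis
    by (simp add: valuation_ideal_def)
qed

lemma carrier_residue_field:
  "carrier (residue_field L v) = (+>\<^bsub>valuation_ring L v\<^esub>) (valuation_ideal L v) ` \<O>"
  by (auto simp: residue_field_def FactRing_def A_RCOSETS_def' valuation_ring_simps)

text \<open>The \<open>n\<close>-fold multiple of one is the residue class of \<open>n\<close>,
  which vanishes, and \<open>ring_char\<close> is the gcd of all such \<open>n\<close>. Applied to 2
  and 3, this makes them units.\<close>

lemma ring_char_residue_field_dvd:
  assumes "of_nat n \<in> \<M>"
  shows "ring_char (residue_field L v) dvd n"
proof -
  interpret Q: ring_hom_ring "valuation_ring L v" "residue_field L v"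
    "(+>\<^bsub>valuation_ring L v\<^esub>) (valuation_ideal L v)"
    by (rule ring_hom_residue)
  have "[n] \<cdot>\<^bsub>residue_field L v\<^esub> \<one>\<^bsub>residue_field L v\<^esub>
    = valuation_ideal L v +>\<^bsub>valuation_ring L v\<^esub> of_nat n" for n :: nat
  proof (induction n)
    case 0
    then show ?case
      using Q.hom_zero by (simp add: valuation_ring_simps)
  next
    case (Suc n)
    have "valuation_ideal L v +>\<^bsub>valuation_ring L v\<^esub> (of_nat n + 1)
      = (valuation_ideal L v +>\<^bsub>valuation_ring L v\<^esub> of_nat n) \<oplus>\<^bsub>residue_field L v\<^esub> \<one>\<^bsub>residue_field L v\<^esub>"
      using Q.hom_add[of "of_nat n" 1] Q.hom_one O_of_nat[of n] by (simp add: valuation_ring_simps)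
    with Suc show ?case
      by (simp add: add_pow_def nat_pow_def add.commute)
  qed
  then have "[n] \<cdot>\<^bsub>residue_field L v\<^esub> \<one>\<^bsub>residue_field L v\<^esub> = \<zero>\<^bsub>residue_field L v\<^esub>"
    using residue_zero_iff[OF O_of_nat[of n]] assms by simp
  then show ?thesis
    unfolding ring_char_def by (simp add: Gcd_dvd)
qed

text \<open>Every point over the residue field lifts to \<O>, so smoothness of the reduced curve
  becomes a statement about congruences modulo \<M>, free of cosets.\<close>

lemma nonsingular_reduction_iff:
  assumes W: "set_weierstrass W \<subseteq> \<O>"
  shows "nonsingular (residue_field L v) (reduction L v W) \<longleftrightarrow>
    (\<forall>x \<in> \<O>. \<forall>y \<in> \<O>. \<not> (
      (y ^ 2 + a1 W * x * y + a3 W * y) - (x ^ 3 + a2 W * x ^ 2 + a4 W * x + a6 W) \<in> \<M> \<and>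
      a1 W * y - (3 * x ^ 2 + 2 * (a2 W * x) + a4 W) \<in> \<M> \<and>
      2 * y + a1 W * x + a3 W \<in> \<M>))"
proof -
  let ?h = "(+>\<^bsub>valuation_ring L v\<^esub>) (valuation_ideal L v)"
  have "singular_point (residue_field L v) (reduction L v W) (?h x) (?h y) \<longleftrightarrow>
      (y ^ 2 + a1 W * x * y + a3 W * y) - (x ^ 3 + a2 W * x ^ 2 + a4 W * x + a6 W) \<in> \<M> \<and>
      a1 W * y - (3 * x ^ 2 + 2 * (a2 W * x) + a4 W) \<in> \<M> \<and>
      2 * y + a1 W * x + a3 W \<in> \<M>" if xy: "x \<in> \<O>" "y \<in> \<O>" for x y
  proof -
    have coeffs: "a1 W \<in> \<O>" "a2 W \<in> \<O>" "a3 W \<in> \<O>" "a4 W \<in> \<O>" "a6 W \<in> \<O>"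
      using W by (cases W; simp)+
    have O: "(y ^ 2 + a1 W * x * y + a3 W * y) - (x ^ 3 + a2 W * x ^ 2 + a4 W * x + a6 W) \<in> \<O>"
      "a1 W * y - (3 * x ^ 2 + 2 * (a2 W * x) + a4 W) \<in> \<O>" "2 * y + a1 W * x + a3 W \<in> \<O>"
      by (intro O_intros xy coeffs)+
    show ?thesis
      unfolding reduction_def
        singular_point_hom[OF ring_hom_residue[unfolded valuation_ring_eq] W xy,
          folded valuation_ring_eq] O[THEN residue_zero_iff] ..
  qed
  then show ?thesis
    unfolding nonsingular_def carrier_residue_field by simp
qed

end

section \<open>Adjoining a root of a uniformizer\<close>

lemma subfield_UNIV: "subfield UNIV (ring_of_type_algebra :: 'a::field ring)"
proof -
  interpret A: Ring.field "ring_of_type_algebra :: 'a ring" by (rule field_from_type_algebra)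
  show ?thesis using A.carrier_is_subfield by simp
qed

lemma subfield_range_to_ac: "subfield (range to_ac) ring_of_type_algebra"
proof -
  interpret ring_hom_ring "ring_of_type_algebra :: 'a::field ring" "ring_of_type_algebra" to_ac
    by (intro ring_hom_ringI ring_from_type_algebra) auto
  show ?thesis
    using img_is_subfield(2)[OF subfield_UNIV] by simp
qed

lemma algebraic_over_range_to_ac:
  fixes x :: "'a::field alg_closure"
  shows "ring.algebraic ring_of_type_algebra (range to_ac) x"
proof -
  let ?A = "ring_of_type_algebra :: 'a alg_closure ring"
  interpret A: Ring.field ?A by (rule field_from_type_algebra)
  obtain p where p: "p \<noteq> 0" "poly (map_poly to_ac p) x = 0"
    by (rule alg_closure_algebraic)
  define q where "q = map_poly to_ac p"
  have q: "q \<noteq> 0" "poly q x = 0"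
    using p by (auto simp: q_def poly_eq_iff coeff_map_poly)
  have pow: "x [^]\<^bsub>?A\<^esub> n = x ^ n" for n :: nat
    by (induction n) (simp_all add: nat_pow_def power_commutes)
  \<comment> \<open>\<open>eval\<close> reads coefficients from the leading one down,
    \<open>Poly\<close> from the constant one up; hence \<open>rev\<close>.\<close>
  have eval: "A.eval (rev xs) x = poly (Poly xs) x" for xs
    by (induction xs rule: rev_induct) (simp_all add: Poly_append poly_monom pow)
  have "(A.algebraic over range to_ac) x"
  proof (rule A.algebraicI[of "rev (coeffs q)"])
    have "set (coeffs q) \<subseteq> range to_ac"
      by (auto simp: coeffs_def q_def coeff_map_poly)
    then show "rev (coeffs q) \<in> carrier (univ_poly ?A (range to_ac))"
      using q(1) by (simp add: univ_poly_def polynomial_def hd_rev last_coeffs_eq_coeff_degree)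
    show "rev (coeffs q) \<noteq> []" using q(1) by simp
    show "A.eval (rev (coeffs q)) x = \<zero>\<^bsub>?A\<^esub>"
      using q(2) by (simp add: eval)
  qed
  then show ?thesis by (simp add: over_def)
qed

text \<open>As the set of polynomial values, so that each element comes with a polynomial on which a
  valuation can be computed. It is a field because \<open>x\<close> is algebraic.\<close>

definition adjoin :: "'a::field alg_closure \<Rightarrow> 'a alg_closure set" where
  "adjoin x = range (\<lambda>p. poly (map_poly to_ac p) x)"

lemma poly_to_ac_simps [simp]:
  fixes p q :: "'a::field poly"
  shows "poly (map_poly to_ac (p + q)) x = poly (map_poly to_ac p) x + poly (map_poly to_ac q) x"
    and "poly (map_poly to_ac (p - q)) x = poly (map_poly to_ac p) x - poly (map_poly to_ac q) x"
    and "poly (map_poly to_ac (p * q)) x = poly (map_poly to_ac p) x * poly (map_poly to_ac q) x"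
    and "poly (map_poly to_ac (pCons a p)) x = to_ac a + x * poly (map_poly to_ac p) x"
    and "poly (map_poly to_ac (Polynomial.monom a n)) x = to_ac a * x ^ n"
proof -
  show pCons: "poly (map_poly to_ac (pCons a p)) x = to_ac a + x * poly (map_poly to_ac p) x" for a p
    by (simp add: map_poly_pCons)
  show add: "poly (map_poly to_ac (p + q)) x = poly (map_poly to_ac p) x + poly (map_poly to_ac q) x" for p q
  proof -
    have "map_poly to_ac (p + q) = map_poly to_ac p + map_poly to_ac q"
      by (simp add: poly_eq_iff coeff_map_poly)
    then show ?thesis by simp
  qed
  show "poly (map_poly to_ac (p - q)) x = poly (map_poly to_ac p) x - poly (map_poly to_ac q) x"
    using add[of "p - q" q] by simp
  have smult: "poly (map_poly to_ac (Polynomial.smult a q)) x = to_ac a * poly (map_poly to_ac q) x" for a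
    by (induction q) (simp_all add: pCons ring_expand)
  show "poly (map_poly to_ac (p * q)) x = poly (map_poly to_ac p) x * poly (map_poly to_ac q) x"
    by (induction p) (simp_all add: pCons add smult ring_expand)
  show "poly (map_poly to_ac (Polynomial.monom a n)) x = to_ac a * x ^ n"
    by (simp add: map_poly_monom poly_monom)
qed

text \<open>The inductive rule for \<open>simple_extension\<close> is a Horner step, which
  corresponds to \<open>pCons\<close>.\<close>

lemma adjoin_eq_simple_extension:
  "adjoin x = ring.simple_extension ring_of_type_algebra (range to_ac) (x :: 'a::field alg_closure)"
proof -
  interpret A: ring "ring_of_type_algebra :: 'a alg_closure ring" by (rule ring_from_type_algebra)
  show ?thesis
  proof (intro equalityI subsetI)
    fix y assume "y \<in> adjoin x"
    then obtain p where "y = poly (map_poly to_ac p) x" by (auto simp: adjoin_def)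
    then show "y \<in> A.simple_extension (range to_ac) x"
    proof (induction p arbitrary: y)
      case 0
      then show ?case using A.simple_extension.zero by simp
    next
      case (pCons a p)
      then show ?case
        using A.simple_extension.lin[of "poly (map_poly to_ac p) x" "range to_ac" x "to_ac a"]
        by (simp add: ring_expand)
    qed
  next
    fix y assume "y \<in> A.simple_extension (range to_ac) x"
    then show "y \<in> adjoin x"
    proof induction
      case zero
      then show ?case unfolding adjoin_def by (auto intro: range_eqI[of _ _ 0])
    next
      case (lin k1 k2)
      then obtain p a where "k1 = poly (map_poly to_ac p) x" "k2 = to_ac a"
        by (auto simp: adjoin_def)
      then show ?case
        unfolding adjoin_def by (auto intro!: range_eqI[of _ _ "pCons a p"] simp: ring_expand)
    qed
  qed
qed

lemma finite_extension_adjoin: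
  fixes x :: "'a::field alg_closure"
  shows "finite_extension_field (adjoin x)"
proof -
  interpret A: Ring.field "ring_of_type_algebra :: 'a alg_closure ring"
    by (rule field_from_type_algebra)
  have "to_ac a \<in> adjoin x" for a
    unfolding adjoin_def by (rule range_eqI[of _ _ "[:a:]"]) simp
  then show ?thesis
    using A.simple_extension_is_subfield[OF subfield_range_to_ac, of x]
      A.finite_dimension_simple_extension[OF subfield_range_to_ac, of x]
      algebraic_over_range_to_ac[of x]
    by (auto simp: finite_extension_field_def adjoin_eq_simple_extension over_def)
qed

lemma ereal_less_add_iff: "ereal r < x + ereal e \<longleftrightarrow> ereal (r - e) < x"
  by (cases x) auto

text \<open>\<open>c\<close> generates the value group, so \<open>\<pi>\<close> is a uniformizer.
  The degree \<open>n\<close> is general here and equals 12 in the application.\<close>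

locale uniformizer_root =
  fixes v :: "'a::field \<Rightarrow> ereal" and c :: real and n :: nat and \<pi> :: 'a and \<rho> :: "'a alg_closure"
  assumes v: "discrete_valuation_on UNIV v"
    and c: "0 < c" "v ` (UNIV - {0}) = range (\<lambda>n::int. ereal (c * of_int n))"
    and n: "0 < n" and \<pi>: "v \<pi> = ereal c" and \<rho>: "\<rho> ^ n = to_ac \<pi>"
begin

sublocale K: valued_subfield UNIV v
  by (rule valued_subfield.intro[OF subfield_UNIV v])

text \<open>The value that \<open>\<rho>\<close> must receive, since \<open>n\<close> times it has
  to be \<open>v \<pi>\<close>.\<close>

definition "d = c / real n"

lemma d: "0 < d" "c = d * real n"
  using c(1) n by (simp_all add: d_def)

section \<open>Weights of the terms of a polynomial at \<open>\<rho>\<close>\<close>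

abbreviation "ev p \<equiv> poly (map_poly to_ac p) \<rho>"

text \<open>The least weight \<open>r\<close> is attained at the index \<open>k\<close> only; in
  terms of the Newton polygon, there is no edge of slope \<open>-d\<close>. The ultrametric
  inequality then forces the value at \<open>\<rho>\<close> to have valuation
  \<open>r\<close>.\<close>

definition dominated :: "'a poly \<Rightarrow> nat \<Rightarrow> real \<Rightarrow> bool" where
  "dominated p k r \<longleftrightarrow> v (Polynomial.coeff p k) + ereal (d * real k) = ereal r \<and>
     (\<forall>i. i \<noteq> k \<longrightarrow> ereal r < v (Polynomial.coeff p i) + ereal (d * real i))"

lemma dominated_le: "dominated p k r \<Longrightarrow> ereal r \<le> v (Polynomial.coeff p i) + ereal (d * real i)"
  by (cases "i = k") (auto simp: dominated_def intro: less_imp_le)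

lemma dominated_nonzero: "dominated p k r \<Longrightarrow> p \<noteq> 0"
  by (auto simp: dominated_def)

lemma v_value:
  assumes "a \<noteq> 0"
  obtains z :: int where "v a = ereal (c * of_int z)"
proof -
  have "v a \<in> v ` (UNIV - {0})" using assms by simp
  then show ?thesis using that unfolding c(2) by auto
qed

text \<open>The product of the two lightest terms is strictly lighter than every other product of
  terms, so it cannot be cancelled.\<close>

lemma dominated_mult:
  assumes p: "dominated p k r" and q: "dominated q l s"
  shows "dominated (p * q) (k + l) (r + s)"
proof -
  define t where "t m i = Polynomial.coeff p i * Polynomial.coeff q (m - i)" for m i
  have coeff: "Polynomial.coeff (p * q) m = (\<Sum>i\<le>m. t m i)" for m
    by (simp add: Polynomial.coeff_mult t_def)
  \<comment> \<open>For any index pair other than \<open>(k, l)\<close> at least one factor exceeds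
    its least weight strictly.\<close>
  have large: "ereal (r + s - d * real m) < v (t m i)" if "i \<le> m" "\<not> (m = k + l \<and> i = k)" for m i
  proof -
    let ?j = "m - i"
    have m: "d * real m = d * real i + d * real ?j"
      using that(1) by (simp add: of_nat_diff algebra_simps)
    have v: "v (t m i) = v (Polynomial.coeff p i) + v (Polynomial.coeff q ?j)"
      by (simp add: t_def K.v_mult)
    have le: "ereal r \<le> v (Polynomial.coeff p i) + ereal (d * real i)"
      "ereal s \<le> v (Polynomial.coeff q ?j) + ereal (d * real ?j)"
      using p q by (auto intro: dominated_le)
    have "i \<noteq> k \<or> ?j \<noteq> l" using that by auto
    then have less: "ereal r < v (Polynomial.coeff p i) + ereal (d * real i) \<or>
      ereal s < v (Polynomial.coeff q ?j) + ereal (d * real ?j)"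
      using p q by (auto simp: dominated_def)
    show ?thesis
      using le less K.v_not_MInf[of "Polynomial.coeff p i"] K.v_not_MInf[of "Polynomial.coeff q ?j"]
      unfolding v m
      by (cases "v (Polynomial.coeff p i)"; cases "v (Polynomial.coeff q ?j)") auto
  qed
  have vp: "v (Polynomial.coeff p k) = ereal (r - d * real k)" and vq: "v (Polynomial.coeff q l) = ereal (s - d * real l)"
    using p q unfolding dominated_def
    by (cases "v (Polynomial.coeff p k)", auto) (cases "v (Polynomial.coeff q l)", auto)
  have v_t: "v (t (k + l) k) = ereal (r + s - d * real (k + l))"
    by (simp add: t_def K.v_mult vp vq) (simp add: algebra_simps)
  have "ereal (r + s - d * real (k + l)) < v (\<Sum>i\<in>{..k + l} - {k}. t (k + l) i)"
    by (rule K.v_sum_gt) (auto intro!: large simp del: of_nat_add)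
  moreover have "(\<Sum>i\<le>k + l. t (k + l) i) = t (k + l) k + (\<Sum>i\<in>{..k + l} - {k}. t (k + l) i)"
    by (rule sum.remove) auto
  ultimately have "v (Polynomial.coeff (p * q) (k + l)) = ereal (r + s - d * real (k + l))"
    unfolding coeff using v_t by (simp add: K.v_add_eq)
  moreover have "ereal (r + s - d * real m) < v (Polynomial.coeff (p * q) m)" if "m \<noteq> k + l" for m
    unfolding coeff by (rule K.v_sum_gt) (use that in \<open>auto intro!: large\<close>)
  then have "ereal (r + s) < v (Polynomial.coeff (p * q) m) + ereal (d * real m)" if "m \<noteq> k + l" for m
    using that by (simp add: ereal_less_add_iff)
  ultimately show ?thesis
    by (simp add: dominated_def)
qed

text \<open>For exponents below \<open>n\<close> the weights of nonzero terms lie in distinct cosets of \<open>c \<int>\<close>.\<close>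

lemma dominated_if_degree_less:
  assumes "p \<noteq> 0" "Polynomial.degree p < n"
  obtains k r where "dominated p k r"
proof -
  define S where "S = {i. Polynomial.coeff p i \<noteq> 0}"
  have S: "S \<subseteq> {..<n}" using assms(2) le_degree[of p] by (fastforce simp: S_def)
  then have fin: "finite S" by (rule finite_subset) simp
  have "S \<noteq> {}" using assms(1) by (auto simp: S_def poly_eq_iff)
  define f where "f i = real_of_ereal (v (Polynomial.coeff p i) + ereal (d * real i))" for i
  have f: "v (Polynomial.coeff p i) + ereal (d * real i) = ereal (f i)" if "i \<in> S" for i
    using K.v_finite[of "Polynomial.coeff p i"] that
    by (cases "v (Polynomial.coeff p i)") (auto simp: f_def S_def)
  have inj: "i = j" if "i \<in> S" "j \<in> S" "f i = f j" for i j
  proof -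
    have coeffs: "Polynomial.coeff p i \<noteq> 0" "Polynomial.coeff p j \<noteq> 0" using that by (auto simp: S_def)
    obtain z z' where z: "v (Polynomial.coeff p i) = ereal (c * of_int z)" "v (Polynomial.coeff p j) = ereal (c * of_int z')"
      using v_value[OF coeffs(1)] v_value[OF coeffs(2)] by metis
    have "c * of_int z + d * real i = c * of_int z' + d * real j"
      using that(3) by (simp add: f_def z)
    then have "d * (of_int z * real n + real i) = d * (of_int z' * real n + real j)"
      using d(2) by (simp add: algebra_simps)
    then have "real_of_int (z * int n + int i) = real_of_int (z' * int n + int j)"
      using d(1) by simp
    then have "z * int n + int i = z' * int n + int j"
      by (simp only: of_int_eq_iff)
    then have "(z * int n + int i) mod int n = (z' * int n + int j) mod int n" by simp
    then show "i = j" using S that by (auto simp: subset_iff)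
  qed
  obtain k where k: "k \<in> S" "\<And>i. i \<in> S \<Longrightarrow> f k \<le> f i"
    using ex_is_arg_min_if_finite[OF fin \<open>S \<noteq> {}\<close>, of f] by (auto simp: is_arg_min_linorder)
  have "dominated p k (f k)"
    unfolding dominated_def
  proof (intro conjI allI impI)
    fix i assume "i \<noteq> k"
    show "ereal (f k) < v (Polynomial.coeff p i) + ereal (d * real i)"
    proof (cases "i \<in> S")
      case True
      then show ?thesis using f[OF True] k inj[OF True k(1)] \<open>i \<noteq> k\<close> by (fastforce simp: less_le)
    next
      case False
      then show ?thesis by (simp add: S_def)
    qed
  qed (use f k in simp)
  then show ?thesis by (rule that)
qed

section \<open>The Eisenstein polynomial of \<open>\<rho>\<close> and nonvanishing of dominated
  polynomials\<close>

definition eisenstein :: "'a poly" where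
  "eisenstein = Polynomial.monom 1 n - [:\<pi>:]"

lemma coeff_eisenstein:
  "Polynomial.coeff eisenstein i = (if i = n then 1 else if i = 0 then - \<pi> else 0)"
  using n by (auto simp: eisenstein_def coeff_pCons split: nat.splits)

lemma degree_eisenstein: "Polynomial.degree eisenstein = n"
  by (rule antisym) (auto intro!: degree_le le_degree simp: coeff_eisenstein)

lemma ev_eisenstein: "ev eisenstein = 0"
  by (simp add: eisenstein_def \<rho>)

text \<open>Only the indices 0 and \<open>n\<close> carry nonzero coefficients, and both have weight
  \<open>c\<close>, because \<open>v \<pi> = c = d * n\<close>.\<close>

lemma not_dominated_eisenstein: "\<not> dominated eisenstein k r"
proof
  assume *: "dominated eisenstein k r"
  have w: "v (Polynomial.coeff eisenstein 0) + ereal (d * real 0) = ereal c"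
    "v (Polynomial.coeff eisenstein n) + ereal (d * real n) = ereal c"
    using n d(2) by (auto simp: coeff_eisenstein K.v_minus \<pi>)
  have "k = 0 \<or> k = n"
    using * by (auto simp: dominated_def coeff_eisenstein split: if_splits)
  then show False
    using * w n unfolding dominated_def by (metis less_irrefl neq0_conv)
qed

text \<open>The leading term \<open>a X^m\<close> is replaced by \<open>a \<pi> X^(m-n)\<close>. As
  \<open>\<rho> ^ n = \<pi>\<close>, neither the value at \<open>\<rho>\<close> nor the weight of
  the moved term changes.\<close>

lemma reduce_degree:
  assumes p: "dominated p k r" and deg: "n \<le> Polynomial.degree p"
  obtains q l where "dominated q l r" "Polynomial.degree q < Polynomial.degree p" "ev q = ev p"
proof -
  define m where "m = Polynomial.degree p"
  define a where "a = Polynomial.coeff p m"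
  define q where "q = p - Polynomial.monom a m + Polynomial.monom (a * \<pi>) (m - n)"
  have mn: "n \<le> m" "m - n \<noteq> m" using deg n by (auto simp: m_def)
  have coeff: "Polynomial.coeff q i = (if i = m then 0
      else if i = m - n then Polynomial.coeff p i + a * \<pi> else Polynomial.coeff p i)" for i
    using mn by (auto simp: q_def a_def)
  have "a \<noteq> 0" using deg n by (auto simp: a_def m_def)
  then have "\<bar>v a\<bar> \<noteq> \<infinity>" by (simp add: K.v_finite)
  have "d * real m = c + d * real (m - n)"
    using mn d(2) by (simp add: of_nat_diff algebra_simps)
  then have w: "v (a * \<pi>) + ereal (d * real (m - n)) = v a + ereal (d * real m)"
    using \<open>\<bar>v a\<bar> \<noteq> \<infinity>\<close> by (cases "v a") (auto simp: K.v_mult \<pi>)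
  \<comment> \<open>The dominating index moves exactly when the leading term was the dominating
    one.\<close>
  define l where "l = (if k = m then m - n else k)"
  have "ev q = ev p"
  proof -
    have "\<rho> ^ m = to_ac \<pi> * \<rho> ^ (m - n)"
      using mn \<rho> by (metis le_add_diff_inverse power_add)
    then show ?thesis by (simp add: q_def)
  qed
  moreover have "Polynomial.degree q < m"
  proof -
    have "Polynomial.degree q \<le> m"
      by (rule degree_le) (auto simp: coeff m_def coeff_eq_0)
    moreover have "Polynomial.degree q \<noteq> m"
    proof
      assume *: "Polynomial.degree q = m"
      then have "q = 0" using coeff[of m] by (metis leading_coeff_0_iff)
      then show False using * mn n by simp
    qed
    ultimately show ?thesis by simp
  qed
  moreover have "dominated q l r"
  proof (cases "k = m")
    case True
    have eq: "v (a * \<pi>) + ereal (d * real (m - n)) = ereal r"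
      using p True w by (simp add: dominated_def a_def)
    have "ereal r < v (Polynomial.coeff p (m - n)) + ereal (d * real (m - n))"
      using p True mn(2) by (simp add: dominated_def)
    with eq have "v (a * \<pi>) < v (Polynomial.coeff p (m - n))"
      by (cases "v (a * \<pi>)"; cases "v (Polynomial.coeff p (m - n))") auto
    then have "v (Polynomial.coeff p (m - n) + a * \<pi>) = v (a * \<pi>)"
      by (simp add: K.v_add_eq add.commute)
    then show ?thesis
      using p True mn(2) eq by (auto simp: dominated_def l_def coeff)
  next
    case False
    have gt: "ereal r < v (a * \<pi>) + ereal (d * real (m - n))"
      using p False w by (simp add: dominated_def a_def)
    show ?thesis
    proof (cases "k = m - n")
      case True
      have "v (Polynomial.coeff p k) + ereal (d * real k) = ereal r" using p by (simp add: dominated_def)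
      with gt True have "v (Polynomial.coeff p k) < v (a * \<pi>)"
        by (cases "v (a * \<pi>)"; cases "v (Polynomial.coeff p k)") auto
      then have "v (Polynomial.coeff p k + a * \<pi>) = v (Polynomial.coeff p k)"
        by (simp add: K.v_add_eq)
      then show ?thesis
        using p True False by (auto simp: dominated_def l_def coeff)
    next
      case neq: False
      have "ereal r < v (Polynomial.coeff p (m - n)) + ereal (d * real (m - n))"
        using p neq by (simp add: dominated_def)
      then have "ereal (r - d * real (m - n)) < v (Polynomial.coeff p (m - n))"
        "ereal (r - d * real (m - n)) < v (a * \<pi>)"
        using gt by (simp_all add: ereal_less_add_iff)
      then have "ereal (r - d * real (m - n)) < v (Polynomial.coeff p (m - n) + a * \<pi>)"
        by (simp add: K.v_add_gt)
      then have "ereal r < v (Polynomial.coeff p (m - n) + a * \<pi>) + ereal (d * real (m - n))"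
        by (simp add: ereal_less_add_iff)
      then show ?thesis
        using p neq False by (auto simp: dominated_def l_def coeff)
    qed
  qed
  ultimately show ?thesis using that m_def by blast
qed

text \<open>
  A dominated polynomial of least degree vanishing at \<open>\<rho>\<close> would have degree below \<open>n\<close> and divide
  \<open>X ^ n - \<pi>\<close>, making that polynomial a product of dominated polynomials; but its two terms have
  the same weight.
\<close>

lemma ev_nonzero_if_dominated: "dominated p k r \<Longrightarrow> ev p \<noteq> 0"
proof (induction "Polynomial.degree p" arbitrary: p k r rule: less_induct)
  case less
  show ?case
  proof (cases "n \<le> Polynomial.degree p")
    case True
    then obtain q l where "dominated q l r" "Polynomial.degree q < Polynomial.degree p" "ev q = ev p"
      using reduce_degree less.prems by blast
    then show ?thesis using less.hyps by metis
  next
    case False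
    show ?thesis
    proof
      assume zero: "ev p = 0"
      have p: "p \<noteq> 0" using less.prems by (rule dominated_nonzero)
      \<comment> \<open>A positive degree of \<open>p\<close> is what keeps the cofactor
        \<open>h\<close> below degree \<open>n\<close>.\<close>
      have "Polynomial.degree p \<noteq> 0"
      proof
        assume "Polynomial.degree p = 0"
        then obtain a where "p = [:a:]" by (rule degree_eq_zeroE)
        then show False using zero p by simp
      qed
      define h where "h = eisenstein div p"
      define g where "g = eisenstein mod p"
      have split: "eisenstein = p * h + g" by (simp add: h_def g_def)
      have "ev g = 0"
        using ev_eisenstein zero unfolding split by simp
      \<comment> \<open>A nonzero remainder would be dominated, of smaller degree than
        \<open>p\<close>, and vanish at \<open>\<rho>\<close>, against the induction
        hypothesis.\<close>
      have "g = 0"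
      proof (rule ccontr)
        assume "g \<noteq> 0"
        then have "Polynomial.degree g < Polynomial.degree p"
          using degree_mod_less[OF p, of eisenstein] by (auto simp: g_def)
        moreover from this obtain k' r' where "dominated g k' r'"
          using dominated_if_degree_less[OF \<open>g \<noteq> 0\<close>] False by auto
        ultimately show False using less.hyps \<open>ev g = 0\<close> by blast
      qed
      with split have eq: "eisenstein = p * h" by simp
      then have "h \<noteq> 0" using degree_eisenstein n by auto
      moreover have "Polynomial.degree h < n"
        using degree_eisenstein p \<open>h \<noteq> 0\<close> \<open>Polynomial.degree p \<noteq> 0\<close>
        unfolding eq by (simp add: Polynomial.degree_mult_eq)
      ultimately obtain l s where "dominated h l s"
        by (rule dominated_if_degree_less)
      then show False
        using dominated_mult[OF less.prems] not_dominated_eisenstein eq by metis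
    qed
  qed
qed

text \<open>If \<open>r < s\<close>, all weights of \<open>q\<close> exceed \<open>r\<close>, so
  \<open>p - q\<close> is still dominated by the term of index \<open>k\<close> although it vanishes
  at \<open>\<rho>\<close>.\<close>

lemma dominated_unique:
  assumes "dominated p k r" "dominated q l s" "ev p = ev q"
  shows "r = s"
proof -
  have False if p: "dominated p k r" and q: "dominated q l s" and "ev p = ev q" and "r < s" for p q k l r s
  proof -
    have gt: "ereal r < v (Polynomial.coeff q i) + ereal (d * real i)" for i
      using dominated_le[OF q, of i] \<open>r < s\<close> by (meson less_le_trans ereal_less_eq(3) less_ereal.simps(1))
    have "dominated (p - q) k r"
      unfolding dominated_def
    proof (intro conjI allI impI)
      have pk: "v (Polynomial.coeff p k) + ereal (d * real k) = ereal r"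
        using p by (simp add: dominated_def)
      with gt[of k] have "v (Polynomial.coeff p k) < v (- Polynomial.coeff q k)"
        by (cases "v (Polynomial.coeff p k)"; cases "v (Polynomial.coeff q k)") (auto simp: K.v_minus)
      then have "v (Polynomial.coeff p k + - Polynomial.coeff q k) = v (Polynomial.coeff p k)"
        by (intro K.v_add_eq) auto
      then show "v (Polynomial.coeff (p - q) k) + ereal (d * real k) = ereal r"
        using pk by simp
    next
      fix i assume "i \<noteq> k"
      then have "ereal r < v (Polynomial.coeff p i) + ereal (d * real i)"
        using p by (simp add: dominated_def)
      then have "ereal (r - d * real i) < v (Polynomial.coeff p i)"
        "ereal (r - d * real i) < v (- Polynomial.coeff q i)"
        using gt[of i] by (simp_all add: ereal_less_add_iff K.v_minus)
      then have "ereal (r - d * real i) < v (Polynomial.coeff p i + - Polynomial.coeff q i)"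
        by (intro K.v_add_gt) auto
      then show "ereal r < v (Polynomial.coeff (p - q) i) + ereal (d * real i)"
        by (simp add: ereal_less_add_iff)
    qed
    then show False using ev_nonzero_if_dominated \<open>ev p = ev q\<close> by fastforce
  qed
  then show ?thesis
    using assms by (metis linorder_neqE_linordered_idom)
qed

section \<open>The valuation on the extension generated by \<open>\<rho>\<close>\<close>

definition extended_valuation :: "'a alg_closure \<Rightarrow> ereal" where
  "extended_valuation x = (if x = 0 then \<infinity> else ereal (THE r. \<exists>p k. dominated p k r \<and> ev p = x))"

text \<open>A dominated representative of any degree may be used, so products need no reduction
  modulo \<open>X^n - \<pi>\<close>.\<close>

lemma extended_valuation_ev: "dominated p k r \<Longrightarrow> extended_valuation (ev p) = ereal r"
proof -
  assume p: "dominated p k r"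
  have "(THE s. \<exists>q l. dominated q l s \<and> ev q = ev p) = r"
    using p dominated_unique by (intro the_equality) blast+
  then show ?thesis
    using ev_nonzero_if_dominated[OF p] by (simp add: extended_valuation_def)
qed

lemma adjoin_cases:
  assumes "x \<in> adjoin \<rho>"
  obtains p where "ev p = x" "Polynomial.degree p < n"
proof -
  obtain p where p: "x = ev p" using assms by (auto simp: adjoin_def)
  have "p = eisenstein * (p div eisenstein) + p mod eisenstein" by simp
  then have "ev p = ev (p mod eisenstein)"
    using ev_eisenstein by (metis add_0 mult_zero_left poly_to_ac_simps(1,3))
  moreover have "Polynomial.degree (p mod eisenstein) < n"
    using degree_mod_less[of eisenstein p] degree_eisenstein n by fastforce
  ultimately show ?thesis using p that by metis
qed

lemma adjoin_nonzero_cases: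
  assumes "x \<in> adjoin \<rho>" "x \<noteq> 0"
  obtains p k r where "ev p = x" "Polynomial.degree p < n" "dominated p k r"
    "extended_valuation x = ereal r"
proof -
  obtain p where p: "ev p = x" "Polynomial.degree p < n" using adjoin_cases[OF assms(1)] .
  moreover have "p \<noteq> 0" using p assms by auto
  moreover from this obtain k r where "dominated p k r" using dominated_if_degree_less p by blast
  ultimately show ?thesis using that extended_valuation_ev by metis
qed

lemma extended_valuation_to_ac: "extended_valuation (to_ac a) = v a"
proof (cases "a = 0")
  case True
  then show ?thesis by (simp add: extended_valuation_def)
next
  case False
  then obtain z where z: "v a = ereal (c * of_int z)" by (rule v_value)
  then have "dominated [:a:] 0 (c * of_int z)"
    by (auto simp: dominated_def coeff_pCons split: nat.splits)
  then show ?thesis using extended_valuation_ev[of "[:a:]"] z by simp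
qed

lemma extended_valuation_image:
  "extended_valuation ` (adjoin \<rho> - {0}) = range (\<lambda>z::int. ereal (d * of_int z))"
proof (intro equalityI subsetI)
  fix y assume "y \<in> extended_valuation ` (adjoin \<rho> - {0})"
  then obtain x where x: "x \<in> adjoin \<rho>" "x \<noteq> 0" "y = extended_valuation x" by auto
  obtain p k r where p: "dominated p k r" "extended_valuation x = ereal r"
    using adjoin_nonzero_cases[OF x(1,2)] .
  have vk: "v (Polynomial.coeff p k) + ereal (d * real k) = ereal r" using p by (simp add: dominated_def)
  then have "Polynomial.coeff p k \<noteq> 0" by auto
  then obtain z where "v (Polynomial.coeff p k) = ereal (c * of_int z)" by (rule v_value)
  then have "r = d * of_int (z * int n + int k)"
    using vk d(2) by (simp add: algebra_simps)
  then show "y \<in> range (\<lambda>z::int. ereal (d * of_int z))"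
    using x(3) p(2) by (intro range_eqI[of _ _ "z * int n + int k"]) simp
next
  fix y assume "y \<in> range (\<lambda>z::int. ereal (d * of_int z))"
  then obtain z :: int where y: "y = ereal (d * of_int z)" by auto
  \<comment> \<open>Division of \<open>z\<close> by \<open>n\<close>: the quotient is realized by a
    coefficient \<open>a\<close> of the base field, the remainder by the power
    \<open>\<rho> ^ k\<close>.\<close>
  define k where "k = nat (z mod int n)"
  have "ereal (c * of_int (z div int n)) \<in> v ` (UNIV - {0})" unfolding c(2) by auto
  then obtain a where a: "a \<noteq> 0" "v a = ereal (c * of_int (z div int n))"
    by (metis DiffD2 imageE singletonI)
  have "z = z div int n * int n + int k" using n by (simp add: k_def)
  then have "real_of_int z = of_int (z div int n) * real n + real k"
    by (metis of_int_add of_int_mult of_int_of_nat_eq)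
  then have "c * of_int (z div int n) + d * real k = d * of_int z"
    using d(2) by (simp add: algebra_simps)
  then have "dominated (Polynomial.monom a k) k (d * of_int z)"
    using a by (simp add: dominated_def)
  from extended_valuation_ev[OF this] ev_nonzero_if_dominated[OF this]
  have "extended_valuation (ev (Polynomial.monom a k)) = y" "ev (Polynomial.monom a k) \<in> adjoin \<rho> - {0}"
    unfolding y adjoin_def by blast+
  then show "y \<in> extended_valuation ` (adjoin \<rho> - {0})"
    by (metis image_eqI)
qed

lemma discrete_valuation_extended: "discrete_valuation_on (adjoin \<rho>) extended_valuation"
  unfolding discrete_valuation_on_def
proof (intro conjI ballI)
  fix x y assume xy: "x \<in> adjoin \<rho>" "y \<in> adjoin \<rho>"
  show "extended_valuation (x * y) = extended_valuation x + extended_valuation y"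
  proof (cases "x = 0 \<or> y = 0")
    case True
    have "extended_valuation z \<noteq> - \<infinity>" for z by (simp add: extended_valuation_def)
    with True show ?thesis by (auto simp: extended_valuation_def)
  next
    case False
    obtain p k r where p: "ev p = x" "dominated p k r" "extended_valuation x = ereal r"
      using adjoin_nonzero_cases[of x] xy False by metis
    obtain q l s where q: "ev q = y" "dominated q l s" "extended_valuation y = ereal s"
      using adjoin_nonzero_cases[of y] xy False by metis
    show ?thesis
      using extended_valuation_ev[OF dominated_mult[OF p(2) q(2)]] p q by simp
  qed
  show "min (extended_valuation x) (extended_valuation y) \<le> extended_valuation (x + y)"
  proof (cases "x = 0 \<or> y = 0 \<or> x + y = 0")
    case True
    then show ?thesis by (auto simp: extended_valuation_def)
  next
    case False
    \<comment> \<open>Sums need representatives of degree below \<open>n\<close>: their sum has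
      degree below \<open>n\<close> again, hence is dominated.\<close>
    obtain p k r where p: "ev p = x" "Polynomial.degree p < n" "dominated p k r" "extended_valuation x = ereal r"
      using adjoin_nonzero_cases[of x] xy False by metis
    obtain q l s where q: "ev q = y" "Polynomial.degree q < n" "dominated q l s" "extended_valuation y = ereal s"
      using adjoin_nonzero_cases[of y] xy False by metis
    have "p + q \<noteq> 0" using p q False by (metis map_poly_0 poly_0 poly_to_ac_simps(1))
    moreover have "Polynomial.degree (p + q) < n" using p q by (simp add: degree_add_less)
    ultimately obtain m t where t: "dominated (p + q) m t" by (rule dominated_if_degree_less)
    have tm: "v (Polynomial.coeff p m + Polynomial.coeff q m) + ereal (d * real m) = ereal t"
      using t by (simp add: dominated_def)
    have "ereal r \<le> v (Polynomial.coeff p m) + ereal (d * real m)"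
      "ereal s \<le> v (Polynomial.coeff q m) + ereal (d * real m)"
      using p q by (auto intro: dominated_le)
    then have "min (ereal r) (ereal s) \<le> ereal t"
      using K.v_add[of "Polynomial.coeff p m" "Polynomial.coeff q m"] tm
      by (cases "v (Polynomial.coeff p m)"; cases "v (Polynomial.coeff q m)";
          cases "v (Polynomial.coeff p m + Polynomial.coeff q m)") (auto simp: min_def split: if_splits)
    then show ?thesis
      using extended_valuation_ev[OF t] p q by simp
  qed
next
  show "extended_valuation 0 = \<infinity>" by (simp add: extended_valuation_def)
  show "\<exists>c>0. extended_valuation ` (adjoin \<rho> - {0}) = range (\<lambda>n::int. ereal (c * of_int n))"
    using extended_valuation_image d(1) by blast
qed

end

section \<open>Good reduction and the j-invariant\<close>

text \<open>If the discriminant vanished, the double root of the depressed cubic would give a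
  singular point over the algebraic closure.\<close>

lemma elliptic_curve_imp_discriminant_nonzero:
  fixes E :: "'a::field_char_0 weierstrass"
  assumes "elliptic_curve E"
  shows "discriminant E \<noteq> 0"
proof
  assume "discriminant E = 0"
  define W where "W = map_weierstrass to_ac E"
  \<comment> \<open>The double root of the depressed cubic; for \<open>c4 W = 0\<close> also
    \<open>c6 W = 0\<close>, and the root is 0.\<close>
  define z where "z = (if c4 W = 0 then 0 else - c6 W / c4 W)"
  \<comment> \<open>The point is recovered from \<open>z = 12 x + b2\<close> and the vanishing
    \<open>y\<close>-derivative \<open>2 y + a1 x + a3 = 0\<close>.\<close>
  define x where "x = (z - b2 W) / 12"
  define y where "y = - (a1 W * x + a3 W) / 2"
  have "discriminant W = 0"
    using \<open>discriminant E = 0\<close> by (simp add: W_def map_weierstrass_to_ac)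
  then have eq: "c6 W ^ 2 = c4 W ^ 3"
    using c4_cubed_minus_c6_squared[of W] by simp
  then have z: "z ^ 2 = c4 W" "z ^ 3 - 3 * c4 W * z - 2 * c6 W = 0"
    by (auto simp: z_def power2_eq_square power3_eq_cube field_simps)
  have yx: "a3 W = - 2 * y - a1 W * x" "z = 12 * x + b2 W"
    by (simp_all add: y_def x_def)
  have "ring_hom_ring (ring_of_type_algebra\<lparr>carrier := UNIV\<rparr>) (ring_of_type_algebra :: 'a alg_closure ring) (\<lambda>x. x)"
    by (rule ring_hom_ringI) (use ring_from_type_algebra in \<open>auto simp: ring_of_type_algebra_def\<close>)
  note singular_iff = singular_point_hom[OF this, of W x y]
  have cancel: "p = 0" if "1728 * p = 0 \<or> 48 * p = 0" for p :: "'a alg_closure"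
    using that by simp
  have "(y ^ 2 + a1 W * x * y + a3 W * y) - (x ^ 3 + a2 W * x ^ 2 + a4 W * x + a6 W) = 0"
    using weierstrass_depressed[OF yx] unfolding z
    by (intro cancel) (simp only: minus_zero simp_thms)
  moreover have "a1 W * y - (3 * x ^ 2 + 2 * (a2 W * x) + a4 W) = 0"
    using weierstrass_deriv_depressed[OF yx] unfolding z
    by (intro cancel) (simp only: diff_self minus_zero simp_thms)
  ultimately have "singular_point ring_of_type_algebra W x y"
    using singular_iff yx(1) by (simp add: weierstrass.map_ident)
  then show False
    using assms by (simp add: elliptic_curve_def nonsingular_def W_def)
qed

section \<open>Unit discriminants, smooth reduction and integrality of \<open>j\<close>\<close>

context valued_subfield
begin

lemma O_coeffs:
  assumes "set_weierstrass W \<subseteq> \<O>"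
  shows "a1 W \<in> \<O>" "a2 W \<in> \<O>" "a3 W \<in> \<O>" "a4 W \<in> \<O>" "a6 W \<in> \<O>"
  using assms by (cases W; simp)+

lemma O_invariants:
  assumes "set_weierstrass W \<subseteq> \<O>"
  shows "b2 W \<in> \<O>" "b4 W \<in> \<O>" "b6 W \<in> \<O>" "c4 W \<in> \<O>" "c6 W \<in> \<O>" "discriminant W \<in> \<O>"
proof -
  note W = O_coeffs[OF assms]
  show b: "b2 W \<in> \<O>" "b4 W \<in> \<O>" "b6 W \<in> \<O>"
    unfolding b2_def b4_def b6_def by (intro O_intros W)+
  have b8: "b8 W \<in> \<O>"
    unfolding b8_def by (intro O_intros W)
  show "c4 W \<in> \<O>" "c6 W \<in> \<O>" "discriminant W \<in> \<O>"
    unfolding c4_def c6_def discriminant_def by (intro O_intros b b8)+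
qed

lemma v_2_3_power:
  assumes "v 2 = 0" "v 3 = 0"
  shows "v (2 ^ m * 3 ^ n) = 0"
  using assms by (simp add: v_mult v_power)

text \<open>If the discriminant lies in \<M>, the double root can be constructed modulo \<M>. All
  divisions are by units, so the singular point has coordinates in \<O>.\<close>

lemma discriminant_unit_if_nonsingular_reduction:
  assumes v23: "v 2 = 0" "v 3 = 0" and W: "set_weierstrass W \<subseteq> \<O>"
    and nonsing: "nonsingular (residue_field L v) (reduction L v W)"
  shows "v (discriminant W) = 0"
proof (rule ccontr)
  assume "v (discriminant W) \<noteq> 0"
  note O = O_coeffs[OF W] O_invariants[OF W]
  then have \<Delta>: "discriminant W \<in> \<M>"
    using \<open>v (discriminant W) \<noteq> 0\<close> by (auto simp: less_le)
  have units: "v 12 = 0" "v 48 = 0" "v 1728 = 0"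
    using v_2_3_power[OF v23, of 2 1] v_2_3_power[OF v23, of 4 1] v_2_3_power[OF v23, of 6 3] by simp_all
  \<comment> \<open>Being a unit replaces the condition \<open>c4 W \<noteq> 0\<close>. If
    \<open>c4 W\<close> lies in \<M>, so does \<open>c6 W\<close>, and 0 is a triple root modulo
    \<M>.\<close>
  define z where "z = (if v (c4 W) = 0 then - c6 W * inverse (c4 W) else 0)"
  have diff: "c4 W ^ 3 - c6 W ^ 2 \<in> \<M>"
    unfolding c4_cubed_minus_c6_squared by (intro M_closed \<Delta> O_numeral)
  have z: "z \<in> \<O>" "z ^ 2 - c4 W \<in> \<M>" "z ^ 3 - 3 * c4 W * z - 2 * c6 W \<in> \<M>"
  proof -
    show "z \<in> \<O>"
    proof (cases "v (c4 W) = 0")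
      case True
      then show ?thesis
        unfolding z_def if_P[OF True] using O by (intro O_closed O O_inverse) auto
    next
      case False
      then show ?thesis
        unfolding z_def if_not_P[OF False] by (intro O_closed)
    qed
    have "z ^ 2 - c4 W \<in> \<M> \<and> z ^ 3 - 3 * c4 W * z - 2 * c6 W \<in> \<M>"
    proof (cases "v (c4 W) = 0")
      case True
      define i where "i = inverse (c4 W)"
      have i: "i \<in> \<O>" using True O O_inverse by (simp add: i_def)
      have "c4 W \<noteq> 0" using True by auto
      then have ci: "c4 W * i = 1" by (simp add: i_def)
      have z: "z = - c6 W * i" using True by (simp add: z_def i_def)
      \<comment> \<open>Terms that vanish by \<open>c4 W * i = 1\<close> are split off; what remains
        is a multiple of \<open>c4 W ^ 3 - c6 W ^ 2\<close>.\<close>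
      have "z ^ 2 - c4 W = - ((c4 W ^ 3 - c6 W ^ 2) * i ^ 2) + ((c4 W * i) ^ 2 - 1) * c4 W"
        unfolding z by (simp add: ring_expand)
      then have 1: "z ^ 2 - c4 W = - ((c4 W ^ 3 - c6 W ^ 2) * i ^ 2)"
        unfolding ci by simp
      have "z ^ 3 - 3 * c4 W * z - 2 * c6 W = (c4 W ^ 3 - c6 W ^ 2) * (c6 W * i ^ 3)
        + 3 * c6 W * (c4 W * i - 1) - c6 W * ((c4 W * i) ^ 3 - 1)"
        unfolding z by (simp add: ring_expand)
      then have 2: "z ^ 3 - 3 * c4 W * z - 2 * c6 W = (c4 W ^ 3 - c6 W ^ 2) * (c6 W * i ^ 3)"
        unfolding ci by simp
      show ?thesis
        unfolding 1 2 by (intro conjI M_closed diff O_intros i O)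
    next
      case False
      then have c4: "c4 W \<in> \<M>" using O by (auto simp: less_le)
      have "c6 W ^ 2 = c4 W ^ 3 - (c4 W ^ 3 - c6 W ^ 2)" by simp
      also have "\<dots> \<in> \<M>" by (intro M_closed diff M_power c4) simp
      finally have c6: "c6 W \<in> \<M>" by (rule M_powerD) (use O in simp)
      have "- c4 W \<in> \<M>" "- (2 * c6 W) \<in> \<M>"
        by (intro M_closed(3,6) O_numeral c4 c6)+
      then show ?thesis using False by (simp add: z_def)
    qed
    then show "z ^ 2 - c4 W \<in> \<M>" "z ^ 3 - 3 * c4 W * z - 2 * c6 W \<in> \<M>" by blast+
  qed
  \<comment> \<open>Again \<open>z = 12 x + b2\<close> and \<open>2 y + a1 x + a3 = 0\<close> are
    solved, now with inverses of units of \<O>.\<close>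
  define x where "x = (z - b2 W) * inverse 12"
  define y where "y = - (a1 W * x + a3 W) * inverse 2"
  have x: "x \<in> \<O>"
    unfolding x_def by (intro O_closed z O O_inverse L_closed' units)
  have y: "y \<in> \<O>"
    unfolding y_def by (intro O_closed x O O_inverse L_closed' v23)
  have n0: "(12 :: 'b) \<noteq> 0" "(2 :: 'b) \<noteq> 0" using units v23 by auto
  have "12 * x = z - b2 W"
    unfolding x_def mult.left_commute[of 12] right_inverse[OF n0(1)] by simp
  moreover have "2 * y = - (a1 W * x + a3 W)"
    unfolding y_def mult.left_commute[of 2] right_inverse[OF n0(2)] by simp
  ultimately have yx: "a3 W = - 2 * y - a1 W * x" "z = 12 * x + b2 W"
    by simp_all
  have "1728 * ((y ^ 2 + a1 W * x * y + a3 W * y) - (x ^ 3 + a2 W * x ^ 2 + a4 W * x + a6 W)) \<in> \<M>"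
    unfolding weierstrass_depressed[OF yx] by (intro M_closed z)
  then have 1: "(y ^ 2 + a1 W * x * y + a3 W * y) - (x ^ 3 + a2 W * x ^ 2 + a4 W * x + a6 W) \<in> \<M>"
    by (rule M_unit_cancel) (use x y O units in auto)
  have "48 * (a1 W * y - (3 * x ^ 2 + 2 * (a2 W * x) + a4 W)) \<in> \<M>"
    unfolding weierstrass_deriv_depressed[OF yx] by (intro M_closed z)
  then have 2: "a1 W * y - (3 * x ^ 2 + 2 * (a2 W * x) + a4 W) \<in> \<M>"
    by (rule M_unit_cancel) (use x y O units in auto)
  have 3: "2 * y + a1 W * x + a3 W \<in> \<M>"
    using M_closed(1) yx(1) by simp
  show False
    using nonsing x y 1 2 3 unfolding nonsingular_reduction_iff[OF W] by blast
qed

text \<open>At a singular point modulo \<M> one has \<open>y = 0\<close>, \<open>A = - 3 x^2\<close>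
  and \<open>B = 2 x^3\<close>, whence \<open>4 A^3 + 27 B^2 = 0\<close> modulo \<M>.\<close>

lemma nonsingular_reduction_if_discriminant_unit:
  assumes v2: "v 2 = 0" and AB: "A \<in> \<O>" "B \<in> \<O>"
    and \<Delta>: "v (discriminant (Weierstrass 0 0 0 A B)) = 0"
  shows "nonsingular (residue_field L v) (reduction L v (Weierstrass 0 0 0 A B))"
proof -
  have W: "set_weierstrass (Weierstrass 0 0 0 A B) \<subseteq> \<O>"
    using AB O_closed(1) by simp
  have False
    if x: "x \<in> \<O>" and y: "y \<in> \<O>" and e1: "y ^ 2 - (x ^ 3 + A * x + B) \<in> \<M>"
      and e2: "- (3 * x ^ 2 + A) \<in> \<M>" and e3: "2 * y \<in> \<M>" for x y
  proof -
    have y': "y \<in> \<M>" using M_unit_cancel[OF e3] y v2 by simp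
    \<comment> \<open>\<open>s\<close> and \<open>p\<close> are the errors in these congruences for
      \<open>A\<close> and \<open>B\<close>.\<close>
    define s where "s = - (3 * x ^ 2 + A)"
    define p where "p = s * x + y ^ 2 - (y ^ 2 - (x ^ 3 + A * x + B))"
    have s: "s \<in> \<M>" using e2 by (simp add: s_def)
    have p: "p \<in> \<M>"
      unfolding p_def by (intro M_closed s x e1 M_power y') simp
    have A: "A = - s - 3 * x ^ 2" and B: "B = 2 * x ^ 3 + p"
      by (simp_all add: s_def p_def ring_expand)
    \<comment> \<open>The terms \<open>108 x^6\<close> cancel, and everything left is a multiple of
      \<open>p\<close> or \<open>s\<close>.\<close>
    have "discriminant (Weierstrass 0 0 0 A B) =
      - 16 * (p * (108 * x ^ 3 + 27 * p) - s * (108 * x ^ 4 + 36 * x ^ 2 * s + 4 * s ^ 2))"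
      unfolding discriminant_short A B by (simp add: ring_expand)
    also have "\<dots> \<in> \<M>"
      using s p by (intro M_closed O_intros x s p) auto
    finally show False using \<Delta> by simp
  qed
  then show ?thesis
    unfolding nonsingular_reduction_iff[OF W] by auto
qed

text \<open>Scaling by \<open>u\<close> divides the discriminant by \<open>u ^ 12\<close> and makes
  it a unit; integrality of \<open>j\<close> then forces the short model to be integral.\<close>

lemma good_reduction_if_discriminant_twelfth_power:
  assumes v23: "v 2 = 0" "v 3 = 0" and E: "set_weierstrass E \<subseteq> L"
    and u: "u \<in> L" "u \<noteq> 0" "v (discriminant E) = v (u ^ 12)"
    and j: "0 \<le> v (j_invariant E)"
  shows "good_reduction L v E"
proof -
  have E': "a1 E \<in> L" "a2 E \<in> L" "a3 E \<in> L" "a4 E \<in> L" "a6 E \<in> L"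
    using E by (cases E; simp)+
  then have b: "b2 E \<in> L" "b4 E \<in> L" "b6 E \<in> L" "b8 E \<in> L"
    by (auto simp: b2_def b4_def b6_def b8_def)
  then have L: "c4 E \<in> L" "c6 E \<in> L" "discriminant E \<in> L"
    by (auto simp: c4_def c6_def discriminant_def)
  have "v (u ^ 12) \<noteq> \<infinity>"
    using u v_eq_infinity_iff[of "u ^ 12"] by simp
  then have \<Delta>0: "discriminant E \<noteq> 0" using u(3) by auto
  have two_three: "(2::'b) \<noteq> 0" "(3::'b) \<noteq> 0" using v23 by auto
  have units: "v 48 = 0" "v 864 = 0" "v 1728 = 0"
    using v_2_3_power[OF v23, of 4 1] v_2_3_power[OF v23, of 5 3] v_2_3_power[OF v23, of 6 3] by simp_all
  define r where "r = - b2 E / 12"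
  define s where "s = - a1 E / 2"
  define t where "t = - (a3 E + r * a1 E) / 2"
  \<comment> \<open>\<open>c\<close> and \<open>c'\<close> are the invariants \<open>c4\<close> and
    \<open>c6\<close> of the scaled model \<open>W\<close>.\<close>
  define c where "c = c4 E / u ^ 4"
  define c' where "c' = c6 E / u ^ 6"
  define W where "W = change_variables u r s t E"
  have rst: "r \<in> L" "s \<in> L" "t \<in> L"
    using E' b by (auto simp: r_def s_def t_def)
  have "W = Weierstrass 0 0 0 (- c4 E / (48 * u ^ 4)) (- c6 E / (864 * u ^ 6))"
    unfolding W_def s_def t_def r_def by (rule change_variables_short[OF two_three])
  then have W: "W = Weierstrass 0 0 0 (- c * inverse 48) (- c' * inverse 864)"
    by (simp only: c_def c'_def divide_inverse inverse_mult_distrib mult_minus_left mult_minus_right mult_ac)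
  have \<Delta>: "discriminant W = discriminant E / u ^ 12"
    by (simp add: W_def discriminant_change_variables)
  then have v\<Delta>: "v (discriminant W) = 0"
    using u L v_finite[of "u ^ 12"]
    by (cases "v (u ^ 12)") (auto simp: divide_inverse v_mult v_inverse)
  have \<Delta>W: "discriminant W \<in> \<O>" using v\<Delta> \<Delta> L u by auto
  have "c ^ 3 = j_invariant E * discriminant W"
    using \<Delta>0 by (simp add: \<Delta> c_def j_invariant_def power_divide power_mult[symmetric])
  also have "\<dots> \<in> \<O>"
    using j L by (intro O_closed \<Delta>W) (auto simp: j_invariant_def)
  finally have c: "c \<in> \<O>"
    by (rule O_powerD) (use u L in \<open>auto simp: c_def\<close>)
  have "c' ^ 2 = (c6 E ^ 2) / u ^ 12"
    by (simp add: c'_def power_divide power_mult[symmetric])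
  also have "\<dots> = (c4 E ^ 3 - 1728 * discriminant E) / u ^ 12"
    using c4_cubed_minus_c6_squared[of E] by (simp add: algebra_simps)
  also have "\<dots> = c ^ 3 - 1728 * discriminant W"
    by (simp add: c_def \<Delta> diff_divide_distrib power_divide power_mult[symmetric])
  also have "\<dots> \<in> \<O>"
    by (intro O_intros c \<Delta>W)
  finally have c': "c' \<in> \<O>"
    by (rule O_powerD) (use u L in \<open>auto simp: c'_def\<close>)
  have AB: "- c * inverse 48 \<in> \<O>" "- c' * inverse 864 \<in> \<O>"
    by (intro O_closed c c' O_inverse L_closed' units)+
  have "integral_model L v E W"
    unfolding integral_model_def
  proof (intro conjI)
    show "\<exists>u\<in>L. \<exists>r\<in>L. \<exists>s\<in>L. \<exists>t\<in>L. u \<noteq> 0 \<and> W = change_variables u r s t E"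
      using u rst W_def by blast
    show "set_weierstrass W \<subseteq> carrier (valuation_ring L v)"
      unfolding W valuation_ring_simps using AB O_closed(1) by simp
  qed
  \<comment> \<open>A unit discriminant is minimal because every integral model has its discriminant
    in \<O>.\<close>
  moreover have "v (discriminant W) \<le> v (discriminant W')" if "integral_model L v E W'" for W'
    using O_invariants(6)[of W'] that v\<Delta> by (simp add: integral_model_def valuation_ring_simps)
  moreover have "nonsingular (residue_field L v) (reduction L v W)"
    using nonsingular_reduction_if_discriminant_unit[OF v23(1) AB] v\<Delta> by (simp add: W)
  ultimately show ?thesis
    by (auto simp: good_reduction_def minimal_model_def)
qed

text \<open>As \<open>j\<close> is the same for all models, it can be read off from the one with
  unit discriminant.\<close>

lemma j_integral_if_good_reduction:
  assumes v23: "v 2 = 0" "v 3 = 0" and E: "good_reduction L v E"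
  shows "0 \<le> v (j_invariant E)"
proof -
  obtain W where W: "minimal_model L v E W" "nonsingular (residue_field L v) (reduction L v W)"
    using E by (auto simp: good_reduction_def)
  then obtain u r s t where u: "u \<noteq> 0" "W = change_variables u r s t E"
    and O: "set_weierstrass W \<subseteq> \<O>"
    by (auto simp: minimal_model_def integral_model_def valuation_ring_simps)
  have "v (discriminant W) = 0"
    by (rule discriminant_unit_if_nonsingular_reduction[OF v23 O W(2)])
  then have "c4 W ^ 3 * inverse (discriminant W) \<in> \<O>"
    using O_invariants[OF O] by (intro O_intros O_inverse) auto
  then show ?thesis
    using j_invariant_change_variables[OF u(1), of r s t E] u(2)
    by (simp add: j_invariant_def divide_inverse)
qed

end

theorem corollary10p6p1:
  fixes v :: "'a::field_char_0 \<Rightarrow> ereal" and E :: "'a weierstrass"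
  assumes "discrete_valuation_on UNIV v"
    and "complete_valuation v"
    and "algebraically_closed (residue_field UNIV v)"
    and "ring_char (residue_field UNIV v) = 0 \<or> ring_char (residue_field UNIV v) > 3"
    and "elliptic_curve E"
  shows "potential_good_reduction v E \<longleftrightarrow> v (j_invariant E) \<ge> 0"
proof -
  interpret K: valued_subfield UNIV v
    by (rule valued_subfield.intro[OF subfield_UNIV assms(1)])
  \<comment> \<open>A residue characteristic that is 0 or exceeds 3 divides no positive
    \<open>n\<close> up to 3.\<close>
  have unit: "v (of_nat n) = 0" if "0 < n" "n \<le> 3" for n :: nat
  proof (rule ccontr)
    assume "v (of_nat n) \<noteq> 0"
    then have "ring_char (residue_field UNIV v) dvd n"
      using K.O_of_nat[of n] by (intro K.ring_char_residue_field_dvd) (auto simp: less_le)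
    then show False
      using assms(4) that by (auto dest: dvd_imp_le)
  qed
  have v23: "v 2 = 0" "v 3 = 0"
    using unit[of 2] unit[of 3] by simp_all
  show ?thesis
  proof
    assume "potential_good_reduction v E"
    then obtain L w where L: "finite_extension_field L" "discrete_valuation_on L w"
      and w: "\<And>x. w (to_ac x) = v x" and good: "good_reduction L w (map_weierstrass to_ac E)"
      by (auto simp: potential_good_reduction_def)
    interpret L: valued_subfield L w
      using L by (auto intro: valued_subfield.intro simp: finite_extension_field_def)
    have "w 2 = 0" "w 3 = 0"
      using w[of 2] w[of 3] v23 by simp_all
    from L.j_integral_if_good_reduction[OF this good] show "v (j_invariant E) \<ge> 0"
      by (simp add: map_weierstrass_to_ac w)
  next
    assume j: "v (j_invariant E) \<ge> 0"
    obtain c where c: "0 < c" "v ` (UNIV - {0}) = range (\<lambda>n::int. ereal (c * of_int n))"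
      using assms(1) by (auto simp: discrete_valuation_on_def)
    have "ereal (c * of_int 1) \<in> v ` (UNIV - {0})" unfolding c(2) by (rule rangeI)
    \<comment> \<open>The generator \<open>c\<close> of the value group is attained, so a
      uniformizer exists.\<close>
    then obtain \<pi> where \<pi>: "v \<pi> = ereal c" by (metis imageE mult_1_right of_int_1)
    obtain \<rho> :: "'a alg_closure" where \<rho>: "\<rho> ^ 12 = to_ac \<pi>"
      using nth_root_exists[of 12 "to_ac \<pi>"] by auto
    interpret R: uniformizer_root v c 12 \<pi> \<rho>
      using assms(1) c \<pi> \<rho> by unfold_locales auto
    let ?L = "adjoin \<rho>" and ?w = R.extended_valuation
    have fin: "finite_extension_field ?L" by (rule finite_extension_adjoin)
    interpret L: valued_subfield ?L ?w
      using fin R.discrete_valuation_extended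
      by (auto intro: valued_subfield.intro simp: finite_extension_field_def)
    define E' where "E' = map_weierstrass to_ac E"
    have "discriminant E \<noteq> 0"
      by (rule elliptic_curve_imp_discriminant_nonzero[OF assms(5)])
    \<comment> \<open>Since \<open>c = 12 d\<close>, an element \<open>u\<close> of value
      \<open>d z\<close> has a twelfth power with the valuation \<open>c z\<close> of the
      discriminant.\<close>
    then obtain z :: int where z: "v (discriminant E) = ereal (c * of_int z)"
      by (rule R.v_value)
    have "ereal (R.d * of_int z) \<in> ?w ` (?L - {0})"
      unfolding R.extended_valuation_image by (rule rangeI)
    then obtain u where "u \<in> ?L - {0}" and "ereal (R.d * of_int z) = ?w u"
      by (rule imageE)
    then have u: "u \<in> ?L" "u \<noteq> 0" "?w u = ereal (R.d * of_int z)"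
      by simp_all
    have "?w (discriminant E') = ?w (u ^ 12)"
      unfolding E'_def map_weierstrass_to_ac R.extended_valuation_to_ac z L.v_power[OF u(1)] u(3)
      by (simp add: R.d_def)
    moreover have "?w 2 = 0" "?w 3 = 0"
      using R.extended_valuation_to_ac[of 2] R.extended_valuation_to_ac[of 3] v23 by simp_all
    moreover have "set_weierstrass E' \<subseteq> ?L"
      using fin by (auto simp: E'_def weierstrass.set_map finite_extension_field_def)
    moreover have "0 \<le> ?w (j_invariant E')"
      using j by (simp add: E'_def map_weierstrass_to_ac R.extended_valuation_to_ac)
    ultimately have "good_reduction ?L ?w E'"
      using u by (intro L.good_reduction_if_discriminant_twelfth_power)
    then show "potential_good_reduction v E"
      unfolding potential_good_reduction_def
      using fin R.discrete_valuation_extended R.extended_valuation_to_ac E'_def by blast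
  qed
qed

end
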